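(* Let $X$ be a compact metric space, $r:X\to X$ a Borel measurable map with $0<\#r^{-1}(x)<\infty$ for all $x\in X$, and $\mu$ a Borel probability measure on $X$ that is strongly invariant, i.e. $\int f\,d\mu=\int \frac{1}{\#r^{-1}(x)}\sum_{r(y)=x}f(y)\,d\mu(x)$ for all $f\in C(X)$. Let $m_0\in L^\infty(X,\mu)$ satisfy $\frac{1}{\#r^{-1}(x)}\sum_{r(y)=x}|m_0(y)|^2=1$ for all $x\in X$, and assume $m_0$ is non-singular: $\mu(\{x\in X: m_0(x)=0\})=0$. Let $X_\infty$, $r_\infty$, $\theta_0$, $\mu_\infty$, $\mathcal H=L^2(X_\infty,\mu_\infty)$, $U$, $\pi$ and $\varphi$ be as described in the context. Then $U$ is a unitary operator on $\mathcal H$, $\pi$ is a representation of $L^\infty(X)$ on $\mathcal H$, and: (1) (Covariance) $U\pi(f)U^{-1}=\pi(f\circ r)$ for all $f\in L^\infty(X)$; (2) (Scaling equation) $U\varphi=\pi(m_0)\varphi$; (3) (Orthogonality) $\langle \pi(f)\varphi,\varphi\rangle=\int f\,d\mu$ for all $f\in L^\infty(X)$; (4) (Density) $\{U^{-n}\pi(f)\varphi: n\in\mathbb N,\ f\in L^\infty(X)\}$ is dense in $\mathcal H$. Hence $(\mathcal H,U,\pi,\varphi)$ is the wavelet representation associated to $m_0$.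
   Context: Solenoid: $X_\infty=\{(x_0,x_1,\dots)\in X^{\mathbb N}: r(x_{n+1})=x_n \text{ for all } n\ge 0\}$ with the $\sigma$-algebra generated by cylinder sets; $r_\infty(x_0,x_1,\dots)=(r(x_0),x_0,x_1,\dots)$ (a measurable automorphism); $\theta_0(x_0,x_1,\dots)=x_0$. Put $c(x)=\#r^{-1}(r(x))$ and $W(x)=|m_0(x)|^2/c(x)$, so $\sum_{r(y)=x}W(y)=1$. For $x\in X$, on the fiber $\Omega_x=\{(x_n)\in X_\infty: x_0=x\}$ the path measure $P_x$ is given on cylinders by $P_x(\{(x_n)\in\Omega_x: x_1=z_1,\dots,x_n=z_n\})=W(z_1)\cdots W(z_n)$. The measure $\mu_\infty$ on $X_\infty$ is defined by $\int f\,d\mu_\infty=\int_X\int_{\Omega_x} f\,dP_x\,d\mu(x)$. On $\mathcal H=L^2(X_\infty,\mu_\infty)$: $Uf=(m_0\circ\theta_0)\,(f\circ r_\infty)$, $\pi(f)g=(f\circ\theta_0)\,g$ for $f\in L^\infty(X)$, and $\varphi$ is the constant function $1$. A wavelet representation associated to $m_0$ is a quadruple (Hilbert space, unitary $U$, representation $\pi$ of $L^\infty(X)$, vector $\varphi$) satisfying (1)–(4); it is known to be unique up to isomorphism. *)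

theory Defs
  imports "HOL-Probability.Probability"
begin

definition solenoid :: "('a \<Rightarrow> 'a) \<Rightarrow> (nat \<Rightarrow> 'a) set" where
  "solenoid r = {\<xi>. \<forall>n. r (\<xi> (Suc n)) = \<xi> n}"

definition sol_space :: "('a::topological_space \<Rightarrow> 'a) \<Rightarrow> (nat \<Rightarrow> 'a) measure" where
  "sol_space r = restrict_space (\<Pi>\<^sub>M n\<in>(UNIV::nat set). (borel::'a measure)) (solenoid r)"

definition r_inf :: "('a \<Rightarrow> 'a) \<Rightarrow> (nat \<Rightarrow> 'a) \<Rightarrow> (nat \<Rightarrow> 'a)" where
  "r_inf r \<xi> = (\<lambda>n. if n = 0 then r (\<xi> 0) else \<xi> (n - 1))"

definition theta0 :: "(nat \<Rightarrow> 'a) \<Rightarrow> 'a" where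
  "theta0 \<xi> = \<xi> 0"

definition cfun :: "('a \<Rightarrow> 'a) \<Rightarrow> 'a \<Rightarrow> nat" where
  "cfun r x = card (r -` {r x})"

definition Wfun :: "('a \<Rightarrow> 'a) \<Rightarrow> ('a \<Rightarrow> complex) \<Rightarrow> 'a \<Rightarrow> real" where
  "Wfun r m0 y = (cmod (m0 y))\<^sup>2 / real (cfun r y)"

text \<open>The path measure P_x: a probability measure on the solenoid, determined by its
  values on the cylinders {x_0 = x, x_1 = z_1, ..., x_n = z_n} of the fiber Omega_x.\<close>

definition path_measure ::
  "('a::topological_space \<Rightarrow> 'a) \<Rightarrow> ('a \<Rightarrow> complex) \<Rightarrow> 'a \<Rightarrow> (nat \<Rightarrow> 'a) measure" where
  "path_measure r m0 x = (SOME N. sets N = sets (sol_space r) \<and> prob_space N \<and>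
     (\<forall>n z. z 0 = x \<and> (\<forall>k<n. r (z (Suc k)) = z k) \<longrightarrow>
        emeasure N {\<xi> \<in> space (sol_space r). \<forall>k\<le>n. \<xi> k = z k}
          = ennreal (\<Prod>k\<in>{1..n}. Wfun r m0 (z k))))"

definition mu_inf ::
  "('a::topological_space \<Rightarrow> 'a) \<Rightarrow> ('a \<Rightarrow> complex) \<Rightarrow> 'a measure \<Rightarrow> (nat \<Rightarrow> 'a) measure" where
  "mu_inf r m0 \<mu> = measure_of (space (sol_space r)) (sets (sol_space r))
     (\<lambda>A. \<integral>\<^sup>+ x. emeasure (path_measure r m0 x) A \<partial>\<mu>)"

definition U_op :: "('a \<Rightarrow> 'a) \<Rightarrow> ('a \<Rightarrow> complex) \<Rightarrow> ((nat \<Rightarrow> 'a) \<Rightarrow> complex) \<Rightarrow> (nat \<Rightarrow> 'a) \<Rightarrow> complex" where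
  "U_op r m0 f = (\<lambda>\<xi>. m0 (theta0 \<xi>) * f (r_inf r \<xi>))"

definition pi_op :: "('a \<Rightarrow> complex) \<Rightarrow> ((nat \<Rightarrow> 'a) \<Rightarrow> complex) \<Rightarrow> (nat \<Rightarrow> 'a) \<Rightarrow> complex" where
  "pi_op f g = (\<lambda>\<xi>. f (theta0 \<xi>) * g \<xi>)"

definition phi :: "(nat \<Rightarrow> 'a) \<Rightarrow> complex" where
  "phi = (\<lambda>\<xi>. 1)"

text \<open>L^2 and L^infinity, represented by functions (equality understood almost everywhere).\<close>

definition L2set :: "'b measure \<Rightarrow> ('b \<Rightarrow> complex) set" where
  "L2set M = {f \<in> borel_measurable M. integrable M (\<lambda>x. (cmod (f x))\<^sup>2)}"

definition L2_inner :: "'b measure \<Rightarrow> ('b \<Rightarrow> complex) \<Rightarrow> ('b \<Rightarrow> complex) \<Rightarrow> complex" where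
  "L2_inner M f g = (\<integral>x. f x * cnj (g x) \<partial>M)"

definition L2_norm :: "'b measure \<Rightarrow> ('b \<Rightarrow> complex) \<Rightarrow> real" where
  "L2_norm M f = sqrt (\<integral>x. (cmod (f x))\<^sup>2 \<partial>M)"

definition Linf_set :: "'b measure \<Rightarrow> ('b \<Rightarrow> complex) set" where
  "Linf_set \<mu> = {f \<in> borel_measurable \<mu>. \<exists>C. AE x in \<mu>. cmod (f x) \<le> C}"

definition unitary_L2 :: "'b measure \<Rightarrow> (('b \<Rightarrow> complex) \<Rightarrow> 'b \<Rightarrow> complex) \<Rightarrow> bool" where
  "unitary_L2 M U \<longleftrightarrow>
     (\<forall>f\<in>L2set M. U f \<in> L2set M) \<and>
     (\<forall>f\<in>L2set M. \<forall>g\<in>L2set M. (AE x in M. f x = g x) \<longrightarrow> (AE x in M. U f x = U g x)) \<and>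
     (\<forall>f\<in>L2set M. \<forall>g\<in>L2set M. \<forall>a. AE x in M. U (\<lambda>y. a * f y + g y) x = a * U f x + U g x) \<and>
     (\<forall>f\<in>L2set M. L2_norm M (U f) = L2_norm M f) \<and>
     (\<forall>g\<in>L2set M. \<exists>f\<in>L2set M. AE x in M. U f x = g x)"

definition Uinv :: "'b measure \<Rightarrow> (('b \<Rightarrow> complex) \<Rightarrow> 'b \<Rightarrow> complex) \<Rightarrow> ('b \<Rightarrow> complex) \<Rightarrow> 'b \<Rightarrow> complex" where
  "Uinv M U g = (SOME f. f \<in> L2set M \<and> (AE x in M. U f x = g x))"

definition representation_Linf ::
  "'a measure \<Rightarrow> 'b measure \<Rightarrow> (('a \<Rightarrow> complex) \<Rightarrow> ('b \<Rightarrow> complex) \<Rightarrow> 'b \<Rightarrow> complex) \<Rightarrow> bool" where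
  "representation_Linf \<mu> M p \<longleftrightarrow>
     (\<forall>f\<in>Linf_set \<mu>. \<forall>g\<in>L2set M. p f g \<in> L2set M) \<and>
     (\<forall>f\<in>Linf_set \<mu>. \<exists>C. \<forall>g\<in>L2set M. L2_norm M (p f g) \<le> C * L2_norm M g) \<and>
     (\<forall>f\<in>Linf_set \<mu>. \<forall>f'\<in>Linf_set \<mu>. (AE x in \<mu>. f x = f' x) \<longrightarrow>
        (\<forall>g\<in>L2set M. AE x in M. p f g x = p f' g x)) \<and>
     (\<forall>f\<in>Linf_set \<mu>. \<forall>g\<in>L2set M. \<forall>g'\<in>L2set M. (AE x in M. g x = g' x) \<longrightarrow>
        (AE x in M. p f g x = p f g' x)) \<and>
     (\<forall>f\<in>Linf_set \<mu>. \<forall>g\<in>L2set M. \<forall>g'\<in>L2set M. \<forall>a.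
        AE x in M. p f (\<lambda>y. a * g y + g' y) x = a * p f g x + p f g' x) \<and>
     (\<forall>f\<in>Linf_set \<mu>. \<forall>f'\<in>Linf_set \<mu>. \<forall>g\<in>L2set M. \<forall>a.
        AE x in M. p (\<lambda>y. a * f y + f' y) g x = a * p f g x + p f' g x) \<and>
     (\<forall>f\<in>Linf_set \<mu>. \<forall>f'\<in>Linf_set \<mu>. \<forall>g\<in>L2set M.
        AE x in M. p (\<lambda>y. f y * f' y) g x = p f (p f' g) x) \<and>
     (\<forall>g\<in>L2set M. AE x in M. p (\<lambda>y. 1) g x = g x) \<and>
     (\<forall>f\<in>Linf_set \<mu>. \<forall>g\<in>L2set M. \<forall>h\<in>L2set M.
        L2_inner M (p f g) h = L2_inner M g (p (\<lambda>y. cnj (f y)) h))"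

end

theory Submission
  imports Defs
begin

text \<open>Let \<open>T f (x)\<close> be the average of \<open>f\<close> over the fiber \<open>r\<^sup>-\<^sup>1(x)\<close>. A nonzero Bochner integral forces its
  integrand to be measurable, so strong invariance for continuous functions already makes \<open>T\<close> a Markov
  kernel with \<open>\<mu> T = \<mu>\<close>. On the solenoid the coordinate \<open>\<xi> n\<close> determines all earlier ones; hence the sets
  \<open>{\<xi> n \<in> A}\<close> form a generator of the \<open>\<sigma>\<close>-algebra that is closed under intersection, and
  \<open>P\<^sub>x {\<xi> (n + 1) \<in> A}\<close> is \<open>T\<close> applied to \<open>|m\<^sub>0|\<^sup>2 P\<^sub>\<bullet> {\<xi> n \<in> A}\<close>. Integrated over \<open>\<mu>\<close> this says that
  \<open>r\<^sub>\<infinity>\<close> carries \<open>|m\<^sub>0 \<circ> \<theta>\<^sub>0|\<^sup>2 \<mu>\<^sub>\<infinity>\<close> to \<open>\<mu>\<^sub>\<infinity>\<close>, so \<open>U\<close> is isometric, and it is onto because \<open>m\<^sub>0\<close> vanishes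
  almost nowhere. Finally \<open>U\<^sup>n (h (\<xi> n)) = (m\<^sub>0 (m\<^sub>0 \<circ> r) \<dots> (m\<^sub>0 \<circ> r\<^sup>n\<^sup>-\<^sup>1) h) (\<xi> 0)\<close>, and bounded functions of a single
  coordinate are dense.\<close>

section \<open>The solenoid\<close>

lemma funpow_solenoid:
  assumes "\<xi> \<in> solenoid r"
  shows "(r ^^ k) (\<xi> (n + k)) = \<xi> n"
  using assms by (induction k) (auto simp: solenoid_def funpow_swap1)

lemma r_inf_solenoid: "\<xi> \<in> solenoid r \<Longrightarrow> r_inf r \<xi> \<in> solenoid r"
  by (auto simp: solenoid_def r_inf_def gr0_conv_Suc)

lemma shift_solenoid: "\<xi> \<in> solenoid r \<Longrightarrow> (\<lambda>n. \<xi> (Suc n)) \<in> solenoid r"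
  by (auto simp: solenoid_def)

lemma shift_r_inf: "(\<lambda>n. r_inf r \<xi> (Suc n)) = \<xi>"
  by (auto simp: r_inf_def)

lemma funpow_r_inf_add: "(r_inf r ^^ n) \<xi> (n + k) = \<xi> k"
  by (induction n) (auto simp: r_inf_def)

lemma theta0_funpow_r_inf: "theta0 ((r_inf r ^^ n) \<xi>) = (r ^^ n) (\<xi> 0)"
  by (induction n) (auto simp: r_inf_def theta0_def)

lemma space_sol_space [simp]: "space (sol_space r) = solenoid r"
  by (simp add: sol_space_def space_restrict_space space_PiM)

lemma measurable_coord_sol [measurable]: "(\<lambda>\<xi>. \<xi> n) \<in> borel_measurable (sol_space r)"
  unfolding sol_space_def by (intro measurable_restrict_space1) measurable

lemma measurable_theta0 [measurable]: "theta0 \<in> borel_measurable (sol_space r)"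
  unfolding theta0_def by measurable

lemma measurable_sol_spaceI:
  assumes "\<And>x. x \<in> space M \<Longrightarrow> f x \<in> solenoid r"
    and "\<And>n. (\<lambda>x. f x n) \<in> borel_measurable M"
  shows "f \<in> measurable M (sol_space r)"
  unfolding sol_space_def using assms
  by (intro measurable_restrict_space2 measurable_PiM_single') auto

lemma measurable_r_inf [measurable]:
  assumes "r \<in> borel_measurable borel"
  shows "r_inf r \<in> measurable (sol_space r) (sol_space r)"
proof (rule measurable_sol_spaceI)
  fix n show "(\<lambda>\<xi>. r_inf r \<xi> n) \<in> borel_measurable (sol_space r)"
    using assms by (cases n) (auto simp: r_inf_def)
qed (simp add: r_inf_solenoid)

lemma measurable_shift: "(\<lambda>\<xi> n. \<xi> (Suc n)) \<in> measurable (sol_space r) (sol_space r)"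
  by (rule measurable_sol_spaceI) (auto simp: shift_solenoid)

definition coord_sets :: "('a::topological_space \<Rightarrow> 'a) \<Rightarrow> (nat \<Rightarrow> 'a) set set" where
  "coord_sets r = {{\<xi> \<in> solenoid r. \<xi> n \<in> A} | n A. A \<in> sets borel}"

lemma coord_setE:
  assumes "X \<in> coord_sets r"
  obtains n A where "A \<in> sets borel" "X = {\<xi> \<in> solenoid r. \<xi> n \<in> A}"
  using assms by (auto simp: coord_sets_def)

text \<open>On the solenoid \<open>r ^^ k\<close> sends coordinate \<open>n + k\<close> to
  coordinate \<open>n\<close>, so a condition on an early coordinate can be moved to any later one.
  This brings conditions on different coordinates to a common index.\<close>

lemma coord_set_lift:
  "{\<xi> \<in> solenoid r. \<xi> n \<in> A} = {\<xi> \<in> solenoid r. \<xi> (n + k) \<in> (r ^^ k) -` A}"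
  by (auto simp: funpow_solenoid)

text \<open>The trace of the product sigma-algebra is the smallest one that makes all coordinates
  measurable, so the first inclusion is measurability of the identity out of the generated
  sigma-algebra.\<close>

lemma sets_sol_space: "sets (sol_space r) = sigma_sets (solenoid r) (coord_sets r)"
proof
  have sub: "coord_sets r \<subseteq> Pow (solenoid r)" by (auto simp: coord_sets_def)
  have "(\<lambda>\<xi>. \<xi>) \<in> measurable (sigma (solenoid r) (coord_sets r)) (sol_space r)"
  proof (rule measurable_sol_spaceI)
    fix n show "(\<lambda>\<xi>. \<xi> n) \<in> borel_measurable (sigma (solenoid r) (coord_sets r))"
    proof (rule measurableI)
      fix A :: "'a set" assume "A \<in> sets borel"
      then have "{\<xi> \<in> solenoid r. \<xi> n \<in> A} \<in> sigma_sets (solenoid r) (coord_sets r)"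
        by (auto simp: coord_sets_def)
      then show "(\<lambda>\<xi>. \<xi> n) -` A \<inter> space (sigma (solenoid r) (coord_sets r))
          \<in> sets (sigma (solenoid r) (coord_sets r))"
        using sub by (simp add: vimage_def Int_def conj_commute)
    qed simp
  qed (use sub in simp)
  from measurable_sets[OF this]
  show "sets (sol_space r) \<subseteq> sigma_sets (solenoid r) (coord_sets r)"
    using sub sets.sets_into_space[of _ "sol_space r"] by (auto simp: Int_absorb2)
next
  have "coord_sets r \<subseteq> sets (sol_space r)"
  proof
    fix X assume "X \<in> coord_sets r"
    then obtain n A where A[measurable]: "A \<in> sets borel" and X: "X = {\<xi> \<in> space (sol_space r). \<xi> n \<in> A}"
      by (auto elim: coord_setE)
    show "X \<in> sets (sol_space r)" unfolding X by measurable
  qed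
  then show "sigma_sets (solenoid r) (coord_sets r) \<subseteq> sets (sol_space r)"
    by (metis sets.sigma_sets_subset space_sol_space)
qed

text \<open>Both conditions are moved to coordinate \<open>n + m\<close>, where they combine into
  one.\<close>

lemma Int_stable_coord_sets:
  assumes [measurable]: "r \<in> borel_measurable borel"
  shows "Int_stable (coord_sets r)"
proof (rule Int_stableI)
  fix X Y assume "X \<in> coord_sets r" "Y \<in> coord_sets r"
  then obtain n A m B where
    [measurable]: "A \<in> sets borel" "B \<in> sets borel" and
    XY: "X = {\<xi> \<in> solenoid r. \<xi> n \<in> A}" "Y = {\<xi> \<in> solenoid r. \<xi> m \<in> B}"
    by (elim coord_setE)
  have "X \<inter> Y = {\<xi> \<in> solenoid r. \<xi> (n + m) \<in> (r ^^ m) -` A \<inter> (r ^^ n) -` B}"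
    unfolding XY coord_set_lift[of r n A m] coord_set_lift[of r m B n] by (auto simp: add.commute)
  moreover have "(r ^^ m) -` A \<inter> (r ^^ n) -` B \<in> sets borel"
    by (intro sets.Int measurable_sets_borel[of _ borel] measurable_compose_n) auto
  ultimately show "X \<inter> Y \<in> coord_sets r"
    unfolding coord_sets_def by blast
qed

text \<open>Uniqueness of finite measures on an intersection-stable generator. The whole solenoid is
  itself a coordinate set, so a constant sequence serves as the exhaustion.\<close>

lemma sol_measure_eqI:
  assumes "r \<in> borel_measurable borel" "finite_measure M"
    and "sets M = sets (sol_space r)" "sets N = sets (sol_space r)"
    and "\<And>n A. A \<in> sets borel \<Longrightarrow>
      emeasure M {\<xi> \<in> solenoid r. \<xi> n \<in> A} = emeasure N {\<xi> \<in> solenoid r. \<xi> n \<in> A}"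
  shows "M = N"
proof (rule measure_eqI_generator_eq[where E = "coord_sets r" and \<Omega> = "solenoid r" and A = "\<lambda>_. solenoid r"])
  show "range (\<lambda>_::nat. solenoid r) \<subseteq> coord_sets r"
    by (auto simp: coord_sets_def intro!: exI[of _ UNIV])
  show "emeasure M (solenoid r) \<noteq> \<infinity>"
    using finite_measure.emeasure_finite[OF assms(2)] by simp
  show "coord_sets r \<subseteq> Pow (solenoid r)" by (auto simp: coord_sets_def)
qed (use assms in \<open>auto simp: sets_sol_space Int_stable_coord_sets elim!: coord_setE\<close>)

section \<open>Square-integrable functions\<close>

lemma L2set_iff:
  "f \<in> L2set N \<longleftrightarrow> f \<in> borel_measurable N \<and> (\<integral>\<^sup>+ x. ennreal ((cmod (f x))\<^sup>2) \<partial>N) < \<infinity>"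
  by (auto simp: L2set_def integrable_iff_bounded)

lemma L2set_measurable: "f \<in> L2set N \<Longrightarrow> f \<in> borel_measurable N"
  by (simp add: L2set_def)

lemma L2_norm_nn_integral:
  "f \<in> borel_measurable N \<Longrightarrow> L2_norm N f = sqrt (enn2real (\<integral>\<^sup>+ x. ennreal ((cmod (f x))\<^sup>2) \<partial>N))"
  unfolding L2_norm_def by (subst integral_eq_nn_integral) auto

lemma cmod_add_sq_le: "(cmod (a + b))\<^sup>2 \<le> 2 * (cmod a)\<^sup>2 + 2 * (cmod b)\<^sup>2"
proof -
  have "(cmod (a + b))\<^sup>2 \<le> (cmod a + cmod b)\<^sup>2"
    by (intro power_mono norm_triangle_ineq) simp
  also have "\<dots> \<le> 2 * (cmod a)\<^sup>2 + 2 * (cmod b)\<^sup>2"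
    using sum_squares_bound[of "cmod a" "cmod b"] by (simp add: power2_sum)
  finally show ?thesis .
qed

text \<open>The factor 2 stands in for Minkowski's inequality: with it, two mean-square errors below
  \<open>\<epsilon> / 4\<close> add to less than \<open>\<epsilon>\<close>.\<close>

lemma L2set_add:
  assumes "f \<in> L2set N" "g \<in> L2set N"
  shows "(\<lambda>x. f x + g x) \<in> L2set N"
    and "(\<integral>x. (cmod (f x + g x))\<^sup>2 \<partial>N) \<le> 2 * (\<integral>x. (cmod (f x))\<^sup>2 \<partial>N) + 2 * (\<integral>x. (cmod (g x))\<^sup>2 \<partial>N)"
proof -
  have [measurable]: "f \<in> borel_measurable N" "g \<in> borel_measurable N"
    and int: "integrable N (\<lambda>x. (cmod (f x))\<^sup>2)" "integrable N (\<lambda>x. (cmod (g x))\<^sup>2)"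
    using assms by (auto simp: L2set_def)
  have int_sum: "integrable N (\<lambda>x. 2 * (cmod (f x))\<^sup>2 + 2 * (cmod (g x))\<^sup>2)"
    using int by simp
  have int_add: "integrable N (\<lambda>x. (cmod (f x + g x))\<^sup>2)"
    by (rule Bochner_Integration.integrable_bound[OF int_sum]) (auto simp: cmod_add_sq_le)
  then show "(\<lambda>x. f x + g x) \<in> L2set N" by (simp add: L2set_def)
  have "(\<integral>x. (cmod (f x + g x))\<^sup>2 \<partial>N) \<le> (\<integral>x. 2 * (cmod (f x))\<^sup>2 + 2 * (cmod (g x))\<^sup>2 \<partial>N)"
    by (intro integral_mono int_add int_sum cmod_add_sq_le)
  then show "(\<integral>x. (cmod (f x + g x))\<^sup>2 \<partial>N) \<le> 2 * (\<integral>x. (cmod (f x))\<^sup>2 \<partial>N) + 2 * (\<integral>x. (cmod (g x))\<^sup>2 \<partial>N)"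
    using int by simp
qed

text \<open>The absolute value guards against a negative \<open>C\<close>, which the
  almost-everywhere bound permits on a null measure. Boundedness of \<open>pi_op f\<close> comes
  from here.\<close>

lemma L2set_mult_bounded:
  assumes f: "f \<in> borel_measurable N" "AE x in N. cmod (f x) \<le> C" and g: "g \<in> L2set N"
  shows "(\<lambda>x. f x * g x) \<in> L2set N" and "L2_norm N (\<lambda>x. f x * g x) \<le> \<bar>C\<bar> * L2_norm N g"
proof -
  have [measurable]: "f \<in> borel_measurable N" "g \<in> borel_measurable N"
    and int: "integrable N (\<lambda>x. (cmod (g x))\<^sup>2)"
    using assms by (auto simp: L2set_def)
  have bound: "AE x in N. (cmod (f x * g x))\<^sup>2 \<le> C\<^sup>2 * (cmod (g x))\<^sup>2"
    using f(2)
  proof eventually_elim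
    case (elim x)
    then have "(cmod (f x))\<^sup>2 \<le> C\<^sup>2" by (intro power_mono) auto
    then show ?case by (simp add: norm_mult power_mult_distrib mult_right_mono)
  qed
  have int_C: "integrable N (\<lambda>x. C\<^sup>2 * (cmod (g x))\<^sup>2)" using int by simp
  have int_fg: "integrable N (\<lambda>x. (cmod (f x * g x))\<^sup>2)"
    by (rule Bochner_Integration.integrable_bound[OF int_C]) (use bound in auto)
  then show "(\<lambda>x. f x * g x) \<in> L2set N" by (simp add: L2set_def)
  have "(\<integral>x. (cmod (f x * g x))\<^sup>2 \<partial>N) \<le> (\<integral>x. C\<^sup>2 * (cmod (g x))\<^sup>2 \<partial>N)"
    by (intro integral_mono_AE int_fg int_C bound)
  then have "sqrt (\<integral>x. (cmod (f x * g x))\<^sup>2 \<partial>N) \<le> sqrt (C\<^sup>2 * (\<integral>x. (cmod (g x))\<^sup>2 \<partial>N))"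
    by simp
  then show "L2_norm N (\<lambda>x. f x * g x) \<le> \<bar>C\<bar> * L2_norm N g"
    unfolding L2_norm_def by (simp add: real_sqrt_mult)
qed

lemma L2set_cmult: "g \<in> L2set N \<Longrightarrow> (\<lambda>x. c * g x) \<in> L2set N"
  using L2set_mult_bounded(1)[of "\<lambda>_. c" N "cmod c" g] by simp

lemma L2set_diff:
  assumes "f \<in> L2set N" "g \<in> L2set N"
  shows "(\<lambda>x. f x - g x) \<in> L2set N"
  using L2set_add(1)[OF assms(1) L2set_cmult[OF assms(2), of "-1"]] by simp

lemma (in finite_measure) L2set_bounded:
  assumes "f \<in> borel_measurable M" "\<And>x. cmod (f x) \<le> C"
  shows "f \<in> L2set M"
  using L2set_mult_bounded(1)[of f M C "\<lambda>_. 1"] assms by (auto simp: L2set_def)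

lemma L2set_cong:
  assumes "\<And>x. x \<in> space N \<Longrightarrow> f x = g x"
  shows "f \<in> L2set N \<longleftrightarrow> g \<in> L2set N"
  using assms unfolding L2set_def
  by (auto cong: measurable_cong Bochner_Integration.integrable_cong)

section \<open>Fiber averages\<close>

locale solenoid_filter =
  fixes r :: "'a::metric_space \<Rightarrow> 'a" and \<mu> :: "'a measure" and m0 :: "'a \<Rightarrow> complex"
  assumes r_measurable [measurable]: "r \<in> borel_measurable borel"
    and fiber: "\<And>x. r -` {x} \<noteq> {}" "\<And>x. finite (r -` {x})"
    and prob_mu: "prob_space \<mu>"
    and sets_mu [measurable_cong]: "sets \<mu> = sets borel"
    and strongly_invariant: "\<And>f :: 'a \<Rightarrow> complex. continuous_on UNIV f \<Longrightarrow>
      (\<integral>x. f x \<partial>\<mu>) = (\<integral>x. (1 / of_nat (card (r -` {x}))) * (\<Sum>y\<in>r -` {x}. f y) \<partial>\<mu>)"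
    and m0_Linf: "m0 \<in> Linf_set \<mu>"
    and m0_normalized: "\<And>x. (1 / real (card (r -` {x}))) * (\<Sum>y\<in>r -` {x}. (cmod (m0 y))\<^sup>2) = 1"
    and m0_nonsingular: "emeasure \<mu> {x. m0 x = 0} = 0"
begin

sublocale prob_space \<mu> by (rule prob_mu)

lemma space_mu [simp]: "space \<mu> = UNIV"
  using sets_eq_imp_space_eq[OF sets_mu] by simp

lemma measurable_mu [simp]: "measurable \<mu> N = measurable borel N"
  by (rule measurable_cong_sets[OF sets_mu refl])

lemma prob_UNIV [simp]: "prob UNIV = 1"
  using prob_space by simp

lemma m0_measurable [measurable]: "m0 \<in> borel_measurable borel"
  using m0_Linf by (simp add: Linf_set_def)

lemma card_fiber_pos: "0 < card (r -` {x})"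
  using fiber[of x] by (simp add: card_gt_0_iff)

text \<open>The operator \<open>T\<close> on real functions: the transfer operator of
  \<open>r\<close> with uniform weights on each fiber.\<close>

definition avg :: "('a \<Rightarrow> real) \<Rightarrow> 'a \<Rightarrow> real" where
  "avg f x = (\<Sum>y\<in>r -` {x}. f y) / real (card (r -` {x}))"

lemma avg_bounds: "(\<And>y. 0 \<le> f y) \<Longrightarrow> (\<And>y. f y \<le> 1) \<Longrightarrow> 0 \<le> avg f x \<and> avg f x \<le> 1"
  using sum_bounded_above[of "r -` {x}" f 1] card_fiber_pos[of x]
  by (auto simp: avg_def sum_nonneg)

text \<open>Strong invariance is applied to \<open>f + 1\<close>, whose integral cannot vanish.\<close>

lemma avg_continuous:
  assumes f: "continuous_on UNIV f" and bd: "\<And>x. 0 \<le> f x" "\<And>x. f x \<le> 1"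
  shows "avg f \<in> borel_measurable borel" and "(\<integral>x. avg f x \<partial>\<mu>) = (\<integral>x. f x \<partial>\<mu>)"
proof -
  have [measurable]: "f \<in> borel_measurable borel"
    using f by (rule borel_measurable_continuous_onI)
  have int_f: "integrable \<mu> f"
    by (rule integrable_const_bound[of _ 1]) (use bd in auto)
  define g where "g = (\<lambda>x. complex_of_real (f x + 1))"
  have Tg: "(1 / of_nat (card (r -` {x}))) * (\<Sum>y\<in>r -` {x}. g y) = complex_of_real (avg f x + 1)" for x
    using card_fiber_pos[of x] fiber[of x]
    by (simp add: g_def avg_def sum.distrib field_simps flip: of_real_sum)
  have "continuous_on UNIV g" unfolding g_def using f by (intro continuous_intros)
  then have eq: "(\<integral>x. g x \<partial>\<mu>) = (\<integral>x. complex_of_real (avg f x + 1) \<partial>\<mu>)"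
    using strongly_invariant[of g] by (simp only: Tg)
  have g_int: "(\<integral>x. g x \<partial>\<mu>) = of_real ((\<integral>x. f x \<partial>\<mu>) + 1)"
    unfolding g_def using int_f by (simp only: integral_complex_of_real) (simp add: prob_space)
  have "(\<integral>x. f x \<partial>\<mu>) \<ge> 0" using bd by simp
  then have "(\<integral>x. g x \<partial>\<mu>) \<noteq> 0"
    unfolding g_int of_real_eq_0_iff by linarith
  \<comment> \<open>A non-integrable function has Bochner integral 0 by convention, so the nonzero
    value yields integrability and with it measurability of the fiber average.\<close>
  then have "integrable \<mu> (\<lambda>x. complex_of_real (avg f x + 1))"
    unfolding eq using not_integrable_integral_eq by blast
  then have int1: "integrable \<mu> (\<lambda>x. avg f x + 1)"
    using complex_of_real_integrable_eq by blast
  then have int: "integrable \<mu> (avg f)"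
    using Bochner_Integration.integrable_diff[OF int1, of "\<lambda>_. 1"] by simp
  then show "avg f \<in> borel_measurable borel"
    using borel_measurable_integrable by force
  have "(\<integral>x. avg f x + 1 \<partial>\<mu>) = (\<integral>x. f x \<partial>\<mu>) + 1"
    using eq unfolding g_int integral_complex_of_real by (simp only: of_real_eq_iff)
  then show "(\<integral>x. avg f x \<partial>\<mu>) = (\<integral>x. f x \<partial>\<mu>)"
    using int by (simp add: prob_space)
qed

text \<open>The indicator of a closed set is a pointwise limit of continuous functions with values
  between 0 and 1. Fibers are finite, so the averages converge pointwise as well, and dominated
  convergence carries the integral identity to the limit.\<close>

lemma avg_closed:
  assumes A: "closed A"
  shows "avg (indicator A) \<in> borel_measurable borel" and "(\<integral>x. avg (indicator A) x \<partial>\<mu>) = prob A"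
proof -
  have "avg (indicator A) \<in> borel_measurable borel \<and> (\<integral>x. avg (indicator A) x \<partial>\<mu>) = prob A"
  \<comment> \<open>The distance \<open>infdist\<close> to the empty set is 0 by convention, so the
    approximants below would be constantly 1 there.\<close>
  proof (cases "A = {}")
    case True
    then have "avg (indicator A) = (\<lambda>_. 0)" by (auto simp: avg_def fun_eq_iff)
    then show ?thesis using True by simp
  next
    case False
    define f :: "nat \<Rightarrow> 'a \<Rightarrow> real" where "f n x = max 0 (1 - real n * infdist x A)" for n x
    have cont: "continuous_on UNIV (f n)" for n
      unfolding f_def by (intro continuous_intros)
    have bd: "0 \<le> f n x" "f n x \<le> 1" for n x
      by (auto simp: f_def infdist_nonneg)
    have lim: "(\<lambda>n. f n x) \<longlonglongrightarrow> indicator A x" for x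
    proof (cases "x \<in> A")
      case True
      then show ?thesis by (simp add: f_def)
    next
      case x: False
      then have pos: "infdist x A > 0" using infdist_pos_not_in_closed[OF A False] by simp
      obtain N :: nat where N: "1 / infdist x A < real N" using reals_Archimedean2 by blast
      have "f n x = 0" if "n \<ge> N" for n
      proof -
        have "1 / infdist x A \<le> real n" using N that by linarith
        then show ?thesis using pos by (simp add: f_def field_simps)
      qed
      then have "eventually (\<lambda>n. f n x = 0) sequentially"
        by (auto simp: eventually_sequentially)
      then show ?thesis using x by (simp add: tendsto_eventually)
    qed
    have lim_avg: "(\<lambda>n. avg (f n) x) \<longlonglongrightarrow> avg (indicator A) x" for x
      unfolding avg_def using card_fiber_pos[of x] by (intro tendsto_intros lim) auto
    note m = avg_continuous(1)[OF cont bd]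
    have meas: "avg (indicator A) \<in> borel_measurable borel"
      by (rule borel_measurable_LIMSEQ_real[OF lim_avg m])
    have [measurable]: "A \<in> sets borel" using A by simp
    have [measurable]: "f n \<in> borel_measurable borel" for n
      using cont by (rule borel_measurable_continuous_onI)
    have "(\<lambda>n. \<integral>x. avg (f n) x \<partial>\<mu>) \<longlonglongrightarrow> (\<integral>x. avg (indicator A) x \<partial>\<mu>)"
      by (rule integral_dominated_convergence[where w = "\<lambda>_. 1"])
        (use meas m lim_avg avg_bounds[OF bd] in auto)
    moreover have "(\<lambda>n. \<integral>x. f n x \<partial>\<mu>) \<longlonglongrightarrow> (\<integral>x. indicator A x \<partial>\<mu>)"
      by (rule integral_dominated_convergence[where w = "\<lambda>_. 1"]) (use lim bd in auto)
    ultimately have "(\<integral>x. avg (indicator A) x \<partial>\<mu>) = (\<integral>x. indicator A x \<partial>\<mu>)"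
      using avg_continuous(2)[OF cont bd] LIMSEQ_unique by auto
    then show ?thesis using meas by simp
  qed
  then show "avg (indicator A) \<in> borel_measurable borel" "(\<integral>x. avg (indicator A) x \<partial>\<mu>) = prob A"
    by auto
qed

text \<open>The uniform pmf lives on the discrete sigma-algebra; pushing it through the identity
  puts it on the Borel sets, as a kernel into \<open>prob_algebra borel\<close> requires.\<close>

definition fiber_unif :: "'a \<Rightarrow> 'a measure" where
  "fiber_unif x = distr (measure_pmf (pmf_of_set (r -` {x}))) borel (\<lambda>y. y)"

lemma sets_fiber_unif [simp, measurable_cong]: "sets (fiber_unif x) = sets borel"
  by (simp add: fiber_unif_def)

lemma prob_space_fiber_unif: "prob_space (fiber_unif x)"
  unfolding fiber_unif_def by (rule measure_pmf.prob_space_distr) simp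

lemma nn_integral_fiber_unif:
  assumes "f \<in> borel_measurable borel"
  shows "(\<integral>\<^sup>+ y. f y \<partial>fiber_unif x) = (\<Sum>y\<in>r -` {x}. f y) / of_nat (card (r -` {x}))"
  unfolding fiber_unif_def using assms fiber
  by (subst nn_integral_distr) (auto simp: nn_integral_pmf_of_set ennreal_of_nat_eq_real_of_nat)

lemma emeasure_fiber_unif:
  assumes "A \<in> sets borel"
  shows "emeasure (fiber_unif x) A = ennreal (avg (indicator A) x)"
proof -
  have "emeasure (fiber_unif x) A = (\<integral>\<^sup>+ y. indicator A y \<partial>fiber_unif x)"
    using assms by simp
  also have "\<dots> = (\<Sum>y\<in>r -` {x}. ennreal (indicator A y)) / ennreal (real (card (r -` {x})))"
    using assms by (subst nn_integral_fiber_unif)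
      (auto simp: ennreal_indicator ennreal_of_nat_eq_real_of_nat)
  also have "\<dots> = ennreal (avg (indicator A) x)"
    unfolding avg_def using card_fiber_pos[of x]
    by (subst sum_ennreal) (auto simp: divide_ennreal sum_nonneg)
  finally show ?thesis .
qed

lemma Int_stable_closed: "Int_stable (Collect closed :: 'a set set)"
  by (auto simp: Int_stable_def)

lemma sets_borel_closed: "sets (borel :: 'a measure) = sigma_sets UNIV (Collect closed)"
  by (simp add: borel_eq_closed)

text \<open>Closed sets are an intersection-stable generator of the Borel sets, so the measurability
  already known for them suffices.\<close>

lemma measurable_fiber_unif [measurable]: "fiber_unif \<in> measurable borel (prob_algebra borel)"
proof (rule measurable_prob_algebra_generated[OF sets_borel_closed Int_stable_closed])
  fix A :: "'a set" assume "A \<in> Collect closed"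
  then show "(\<lambda>x. emeasure (fiber_unif x) A) \<in> borel_measurable borel"
    using avg_closed(1)[of A] by (simp add: emeasure_fiber_unif)
qed (auto simp: prob_space_fiber_unif)

text \<open>Strong invariance extended from continuous functions to all Borel sets: two probability
  measures that agree on closed sets are equal.\<close>

lemma bind_fiber_unif: "\<mu> \<bind> fiber_unif = \<mu>"
proof -
  have k: "fiber_unif \<in> measurable \<mu> (subprob_algebra borel)"
    using measurable_prob_algebraD[OF measurable_fiber_unif] by simp
  have sets: "sets (\<mu> \<bind> fiber_unif) = sets borel"
    by (rule sets_bind) auto
  have "\<mu> = \<mu> \<bind> fiber_unif"
  proof (rule measure_eqI_generator_eq[OF Int_stable_closed, where \<Omega> = UNIV and A = "\<lambda>_. UNIV"])
    fix A :: "'a set" assume A: "A \<in> Collect closed"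
    have "emeasure (\<mu> \<bind> fiber_unif) A = (\<integral>\<^sup>+ x. ennreal (avg (indicator A) x) \<partial>\<mu>)"
      using A by (subst emeasure_bind[OF _ k]) (auto simp: emeasure_fiber_unif)
    also have "\<dots> = ennreal (\<integral>x. avg (indicator A) x \<partial>\<mu>)"
    proof (rule nn_integral_eq_integral)
      show "integrable \<mu> (avg (indicator A))"
        using A avg_closed(1)[of A] avg_bounds[of "indicator A"]
        by (intro integrable_const_bound[of _ 1]) auto
    qed (use avg_bounds[of "indicator A"] in auto)
    also have "\<dots> = emeasure \<mu> A"
      using A by (simp add: avg_closed(2) emeasure_eq_measure)
    finally show "emeasure \<mu> A = emeasure (\<mu> \<bind> fiber_unif) A" ..
  qed (auto simp: sets sets_mu sets_borel_closed)
  then show ?thesis ..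
qed

lemma nn_integral_mu_fiber:
  assumes "f \<in> borel_measurable borel"
  shows "(\<integral>\<^sup>+ x. f x \<partial>\<mu>) = (\<integral>\<^sup>+ x. (\<integral>\<^sup>+ y. f y \<partial>fiber_unif x) \<partial>\<mu>)"
proof -
  have k: "fiber_unif \<in> measurable \<mu> (subprob_algebra borel)"
    using measurable_prob_algebraD[OF measurable_fiber_unif] by simp
  show ?thesis
    using nn_integral_bind[OF assms k] by (simp add: bind_fiber_unif)
qed

text \<open>Strong invariance implies ordinary invariance, because the indicator of the preimage of
  \<open>A\<close> is constant on the fiber over \<open>x\<close>, with value
  \<open>indicator A x\<close>.\<close>

lemma distr_mu_r: "distr \<mu> borel r = \<mu>"
proof (rule measure_eqI)
  fix A assume "A \<in> sets (distr \<mu> borel r)"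
  then have A [measurable]: "A \<in> sets borel" by simp
  have "emeasure \<mu> (r -` A) = (\<integral>\<^sup>+ x. indicator (r -` A) x \<partial>\<mu>)"
    using measurable_sets_borel[OF r_measurable A] by (simp add: sets_mu)
  also have "\<dots> = (\<integral>\<^sup>+ x. (\<integral>\<^sup>+ y. indicator (r -` A) y \<partial>fiber_unif x) \<partial>\<mu>)"
    using measurable_sets_borel[OF r_measurable A] by (intro nn_integral_mu_fiber) simp
  also have "\<dots> = (\<integral>\<^sup>+ x. indicator A x \<partial>\<mu>)"
  proof (rule nn_integral_cong)
    fix x
    have "(\<integral>\<^sup>+ y. indicator (r -` A) y \<partial>fiber_unif x)
        = (\<Sum>y\<in>r -` {x}. indicator A x) / of_nat (card (r -` {x}))"
      using measurable_sets_borel[OF r_measurable A]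
      by (subst nn_integral_fiber_unif) (auto intro!: arg_cong2[where f = divide] sum.cong simp: indicator_def)
    also have "\<dots> = indicator A x"
      using card_fiber_pos[of x] by (simp add: ennreal_mult_divide_eq mult.commute)
    finally show "(\<integral>\<^sup>+ y. indicator (r -` A) y \<partial>fiber_unif x) = indicator A x" .
  qed
  finally show "emeasure (distr \<mu> borel r) A = emeasure \<mu> A"
    by (simp add: emeasure_distr sets_mu)
qed (simp add: sets_mu)

section \<open>Transition weights on the fibers\<close>

abbreviation W :: "'a \<Rightarrow> real" where "W \<equiv> Wfun r m0"

lemma W_nonneg: "0 \<le> W y"
  by (simp add: Wfun_def)

lemma W_fiber: "y \<in> r -` {x} \<Longrightarrow> W y = (cmod (m0 y))\<^sup>2 / real (card (r -` {x}))"
  by (auto simp: Wfun_def cfun_def)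

lemma sum_W: "(\<Sum>y\<in>r -` {x}. W y) = 1"
  using m0_normalized[of x] by (simp add: W_fiber flip: sum_divide_distrib)

text \<open>The denominator \<open>cfun\<close> in the weight is the mass of a point under the
  uniform distribution on its fiber. The weighted sum thus becomes an integral against a measurable
  kernel that preserves \<open>\<mu>\<close>.\<close>

lemma sum_W_fiber_unif:
  assumes [measurable]: "g \<in> borel_measurable borel"
  shows "(\<Sum>y\<in>r -` {x}. ennreal (W y) * g y) = (\<integral>\<^sup>+ y. ennreal ((cmod (m0 y))\<^sup>2) * g y \<partial>fiber_unif x)"
proof -
  have "ennreal (W y) * g y = ennreal ((cmod (m0 y))\<^sup>2) * g y * inverse (of_nat (card (r -` {x})))"
    if "y \<in> r -` {x}" for y
    using that card_fiber_pos[of x]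
    by (simp add: W_fiber divide_ennreal[symmetric] divide_ennreal_def
        ennreal_of_nat_eq_real_of_nat mult_ac)
  then show ?thesis
    by (subst nn_integral_fiber_unif) (auto simp: divide_ennreal_def sum_distrib_right)
qed

section \<open>Path measures\<close>

text \<open>Names the property behind the choice in \<open>path_measure\<close>, so that existence
  of one such measure transfers to the chosen one.\<close>

definition path_law :: "'a \<Rightarrow> (nat \<Rightarrow> 'a) measure \<Rightarrow> bool" where
  "path_law x N \<longleftrightarrow> sets N = sets (sol_space r) \<and> prob_space N \<and>
     (\<forall>n z. z 0 = x \<and> (\<forall>k<n. r (z (Suc k)) = z k) \<longrightarrow>
        emeasure N {\<xi> \<in> space (sol_space r). \<forall>k\<le>n. \<xi> k = z k}
          = ennreal (\<Prod>k\<in>{1..n}. W (z k)))"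

lemma finite_funpow_fiber: "finite ((r ^^ n) -` {x})"
proof (induction n arbitrary: x)
  case (Suc n)
  have "(r ^^ Suc n) -` {x} = (\<Union>y\<in>r -` {x}. (r ^^ n) -` {y})" by auto
  then show ?case using Suc fiber by (simp del: funpow.simps)
qed simp

text \<open>The random path uses an independent choice of a preimage at every pair (level, point); a
  cylinder then prescribes finitely many coordinates of a product space.\<close>

lemma path_law_exists: "\<exists>N. path_law x N"
proof -
  \<comment> \<open>The factor at \<open>(k, u)\<close> draws a preimage of \<open>u\<close> with
    weights \<open>W\<close>, which sum to 1 on the fiber.\<close>
  define M where "M = (\<lambda>i::nat \<times> 'a. point_measure (r -` {snd i}) (\<lambda>u. ennreal (W u)))"
  have "prob_space (M i)" for i
    unfolding M_def using fiber sum_W W_nonneg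
    by (intro prob_space_point_measure) (auto simp: sum_ennreal)
  then interpret P: product_prob_space M UNIV
    by (rule product_prob_spaceI)
  define path where "path = (\<lambda>\<omega>::nat \<times> 'a \<Rightarrow> 'a. rec_nat x (\<lambda>k u. \<omega> (k, u)))"
  have path_simps: "path \<omega> 0 = x" "path \<omega> (Suc n) = \<omega> (n, path \<omega> n)" for \<omega> n
    by (simp_all add: path_def)
  have comp: "\<omega> (n, u) \<in> r -` {u}" if "\<omega> \<in> space (PiM UNIV M)" for \<omega> n u
    using that by (auto simp: space_PiM M_def space_point_measure PiE_iff)
  \<comment> \<open>The next point is read off at a random index. Coordinate \<open>n\<close> takes
    only finitely many values, the \<open>n\<close>-th preimages of \<open>x\<close>, so
    measurability reduces to fixed indices.\<close>
  have path_count: "(\<lambda>\<omega>. path \<omega> n) \<in> measurable (PiM UNIV M) (count_space ((r ^^ n) -` {x}))" for n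
  proof (induction n)
    case 0
    then show ?case by (simp add: path_simps)
  next
    case (Suc n)
    have "(\<lambda>\<omega>. \<omega> (n, u)) \<in> measurable (PiM UNIV M) (count_space ((r ^^ Suc n) -` {x}))"
      if u: "u \<in> (r ^^ n) -` {x}" for u
    proof -
      have "(\<lambda>\<omega>. \<omega> (n, u)) \<in> measurable (PiM UNIV M) (M (n, u))"
        by (rule measurable_component_singleton) simp
      moreover have "(\<lambda>v. v) \<in> measurable (M (n, u)) (count_space ((r ^^ Suc n) -` {x}))"
        unfolding M_def using u by (auto simp: funpow_swap1)
      ultimately show ?thesis by (rule measurable_compose)
    qed
    then show ?case
      unfolding path_simps
      by (rule measurable_compose_countable'[OF _ Suc countable_finite[OF finite_funpow_fiber]])
  qed
  have path_borel: "(\<lambda>\<omega>. path \<omega> n) \<in> measurable (PiM UNIV M) borel" for n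
    by (rule measurable_compose[OF path_count, where g = "\<lambda>v. v"]) simp
  have path_sol: "path \<omega> \<in> solenoid r" if "\<omega> \<in> space (PiM UNIV M)" for \<omega>
    using comp[OF that] by (auto simp: solenoid_def path_simps)
  have meas: "path \<in> measurable (PiM UNIV M) (sol_space r)"
    by (rule measurable_sol_spaceI[OF path_sol path_borel])
  define N where "N = distr (PiM UNIV M) (sol_space r) path"
  have "path_law x N"
    unfolding path_law_def
  proof (intro conjI allI impI)
    show "sets N = sets (sol_space r)" by (simp add: N_def)
    show "prob_space N" unfolding N_def by (rule P.prob_space_distr[OF meas])
    fix n z assume z: "z 0 = x \<and> (\<forall>k<n. r (z (Suc k)) = z k)"
    have cyl: "{\<xi> \<in> space (sol_space r). \<forall>k\<le>n. \<xi> k = z k} \<in> sets (sol_space r)"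
      by measurable
    \<comment> \<open>Along the prescribed path the random index \<open>path \<omega> k\<close> is
      \<open>z k\<close>, so the cylinder becomes a condition at deterministic indices.\<close>
    have path_iff: "(\<forall>k\<le>n. path \<omega> k = z k) \<longleftrightarrow> (\<forall>k<n. \<omega> (k, z k) = z (Suc k))" for \<omega>
    proof (induction n)
      case 0
      then show ?case using z by (simp add: path_simps)
    next
      case (Suc n)
      have "(\<forall>k\<le>Suc n. path \<omega> k = z k) \<longleftrightarrow> (\<forall>k\<le>n. path \<omega> k = z k) \<and> \<omega> (n, path \<omega> n) = z (Suc n)"
        by (auto simp: le_Suc_eq path_simps)
      also have "\<dots> \<longleftrightarrow> (\<forall>k\<le>n. path \<omega> k = z k) \<and> \<omega> (n, z n) = z (Suc n)" by auto
      finally show ?case using Suc by (auto simp: less_Suc_eq)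
    qed
    \<comment> \<open>The level in each pair keeps the \<open>n\<close> indices distinct even if
      \<open>z\<close> revisits a point, so the product formula gives one factor per step.\<close>
    define J where "J = (\<lambda>k. (k, z k)) ` {..<n}"
    have "emeasure N {\<xi> \<in> space (sol_space r). \<forall>k\<le>n. \<xi> k = z k}
        = emeasure (PiM UNIV M) {\<omega> \<in> space (PiM UNIV M). \<forall>i\<in>J. \<omega> i \<in> {z (Suc (fst i))}}"
    proof -
      have J_iff: "(\<forall>i\<in>J. \<omega> i \<in> {z (Suc (fst i))}) \<longleftrightarrow> (\<forall>k\<le>n. path \<omega> k = z k)" for \<omega>
        unfolding path_iff J_def by (simp, simp only: Ball_def lessThan_iff)
      have "path -` {\<xi> \<in> space (sol_space r). \<forall>k\<le>n. \<xi> k = z k} \<inter> space (PiM UNIV M)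
          = {\<omega> \<in> space (PiM UNIV M). \<forall>k\<le>n. path \<omega> k = z k}"
        using path_sol by auto
      then show ?thesis
        unfolding N_def J_iff emeasure_distr[OF meas cyl] by (rule arg_cong)
    qed
    also have "\<dots> = (\<Prod>i\<in>J. emeasure (M i) {z (Suc (fst i))})"
      using z by (intro P.emeasure_PiM_Collect) (auto simp: J_def M_def sets_point_measure)
    also have "\<dots> = (\<Prod>k<n. emeasure (M (k, z k)) {z (Suc k)})"
      unfolding J_def by (subst prod.reindex) (auto simp: inj_on_def)
    also have "\<dots> = (\<Prod>k<n. ennreal (W (z (Suc k))))"
      using z by (intro prod.cong) (auto simp: M_def emeasure_point_measure_finite2)
    also have "\<dots> = ennreal (\<Prod>k\<in>{1..n}. W (z k))"
      by (simp add: prod_ennreal W_nonneg prod.atLeast1_atMost_eq)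
    finally show "emeasure N {\<xi> \<in> space (sol_space r). \<forall>k\<le>n. \<xi> k = z k}
        = ennreal (\<Prod>k\<in>{1..n}. W (z k))" .
  qed
  then show ?thesis ..
qed

section \<open>Single coordinates under the path measures\<close>

abbreviation P :: "'a \<Rightarrow> (nat \<Rightarrow> 'a) measure" where "P \<equiv> path_measure r m0"

lemma path_law_P: "path_law x (P x)"
  using someI_ex[OF path_law_exists[of x]] by (simp add: path_measure_def path_law_def)

lemma sets_P [simp, measurable_cong]: "sets (P x) = sets (sol_space r)"
  using path_law_P by (simp add: path_law_def)

lemma space_P [simp]: "space (P x) = solenoid r"
  using sets_eq_imp_space_eq[OF sets_P] by simp

lemma prob_space_P: "prob_space (P x)"
  using path_law_P by (simp add: path_law_def)

text \<open>The cylinder with \<open>n = 0\<close> has the empty product as its mass.\<close>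

lemma AE_P_start: "AE \<xi> in P x. \<xi> 0 = x"
proof -
  interpret Px: prob_space "P x" by (rule prob_space_P)
  have "emeasure (P x) {\<xi> \<in> space (P x). \<xi> 0 = x} = 1"
    using path_law_P[of x, unfolded path_law_def, THEN conjunct2, THEN conjunct2, rule_format,
        of "\<lambda>_. x" 0] by simp
  then show ?thesis
    by (subst Px.AE_iff_emeasure_eq_1) auto
qed

text \<open>The value \<open>y\<close> at coordinate \<open>n\<close> fixes all earlier coordinates
  on the solenoid, so the event is the cylinder of \<open>z k\<close>, the image of \<open>y\<close>
  under \<open>n - k\<close> steps of \<open>r\<close>. Reversing the index gives the product along
  the forward orbit of \<open>y\<close>.\<close>

lemma emeasure_P_endpoint:
  assumes y: "(r ^^ n) y = x"
  shows "emeasure (P x) {\<xi> \<in> solenoid r. \<xi> n = y} = ennreal (\<Prod>k<n. W ((r ^^ k) y))"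
proof -
  define z where "z k = (r ^^ (n - k)) y" for k
  have "r (z (Suc k)) = z k" if "k < n" for k
    using that by (simp add: z_def Suc_diff_Suc flip: funpow.simps(2)[THEN fun_cong, unfolded comp_def])
  then have "emeasure (P x) {\<xi> \<in> space (sol_space r). \<forall>k\<le>n. \<xi> k = z k}
      = ennreal (\<Prod>k\<in>{1..n}. W (z k))"
    using path_law_P[of x] y by (simp add: path_law_def z_def)
  also have "{\<xi> \<in> space (sol_space r). \<forall>k\<le>n. \<xi> k = z k} = {\<xi> \<in> solenoid r. \<xi> n = y}"
  proof -
    have "\<xi> k = z k" if "\<xi> \<in> solenoid r" "\<xi> n = y" "k \<le> n" for \<xi> k
      using funpow_solenoid[OF that(1), of "n - k" k] that by (simp add: z_def)
    then show ?thesis by (auto simp: z_def)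
  qed
  also have "(\<Prod>k\<in>{1..n}. W (z k)) = (\<Prod>k<n. W ((r ^^ (n - Suc k)) y))"
    by (simp add: prod.atLeast1_atMost_eq z_def)
  also have "\<dots> = (\<Prod>k<n. W ((r ^^ k) y))"
    by (rule prod.nat_diff_reindex)
  finally show ?thesis .
qed

text \<open>Almost every path starts at \<open>x\<close>, so up to a null set the event is a finite
  disjoint union over the \<open>n\<close>-th preimages of \<open>x\<close> lying in
  \<open>A\<close>.\<close>

lemma emeasure_P_coord:
  assumes [measurable]: "A \<in> sets borel"
  shows "emeasure (P x) {\<xi> \<in> solenoid r. \<xi> n \<in> A}
    = (\<Sum>y\<in>(r ^^ n) -` {x} \<inter> A. ennreal (\<Prod>k<n. W ((r ^^ k) y)))"
proof -
  let ?F = "\<lambda>y. {\<xi> \<in> solenoid r. \<xi> n = y}"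
  have m: "{\<xi> \<in> solenoid r. Q \<xi>} \<in> sets (P x)"
    if "Measurable.pred (sol_space r) Q" for Q
    using that by (simp add: pred_def)
  have F: "?F y \<in> sets (P x)" for y by (intro m) measurable
  have "emeasure (P x) {\<xi> \<in> solenoid r. \<xi> n \<in> A} = emeasure (P x) (\<Union>y\<in>(r ^^ n) -` {x} \<inter> A. ?F y)"
  proof (rule emeasure_eq_AE)
    show "AE \<xi> in P x. \<xi> \<in> {\<xi> \<in> solenoid r. \<xi> n \<in> A} \<longleftrightarrow> \<xi> \<in> (\<Union>y\<in>(r ^^ n) -` {x} \<inter> A. ?F y)"
      using AE_P_start by eventually_elim (use funpow_solenoid[where n = 0] in auto)
    show "{\<xi> \<in> solenoid r. \<xi> n \<in> A} \<in> sets (P x)" by (intro m) measurable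
    show "(\<Union>y\<in>(r ^^ n) -` {x} \<inter> A. ?F y) \<in> sets (P x)"
      using finite_funpow_fiber F by (intro sets.finite_UN) auto
  qed
  also have "\<dots> = (\<Sum>y\<in>(r ^^ n) -` {x} \<inter> A. emeasure (P x) (?F y))"
    using finite_funpow_fiber F
    by (intro sum_emeasure[symmetric]) (auto simp: disjoint_family_on_def)
  also have "\<dots> = (\<Sum>y\<in>(r ^^ n) -` {x} \<inter> A. ennreal (\<Prod>k<n. W ((r ^^ k) y)))"
    by (intro sum.cong) (auto simp: emeasure_P_endpoint)
  finally show ?thesis .
qed

lemma emeasure_P_0:
  assumes A: "A \<in> sets borel"
  shows "emeasure (P x) {\<xi> \<in> solenoid r. \<xi> 0 \<in> A} = indicator A x"
proof -
  have "(r ^^ 0) -` {x} \<inter> A = (if x \<in> A then {x} else {})" by auto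
  then show ?thesis unfolding emeasure_P_coord[OF A] by simp
qed

text \<open>Markov property at the first step: the preimages \<open>u\<close> of order
  \<open>Suc n\<close> are grouped by their image \<open>y\<close> under \<open>r ^^ n\<close>. The
  last factor of the product is \<open>W y\<close>, and the others form the weight of
  \<open>u\<close> seen from \<open>y\<close>.\<close>

lemma emeasure_P_Suc:
  assumes A: "A \<in> sets borel"
  shows "emeasure (P x) {\<xi> \<in> solenoid r. \<xi> (Suc n) \<in> A}
    = (\<Sum>y\<in>r -` {x}. ennreal (W y) * emeasure (P y) {\<xi> \<in> solenoid r. \<xi> n \<in> A})"
proof -
  let ?w = "\<lambda>n u. \<Prod>k<n. W ((r ^^ k) u)"
  have "(r ^^ Suc n) -` {x} \<inter> A = (\<Union>y\<in>r -` {x}. (r ^^ n) -` {y} \<inter> A)" by auto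
  then have "emeasure (P x) {\<xi> \<in> solenoid r. \<xi> (Suc n) \<in> A}
      = (\<Sum>u\<in>(\<Union>y\<in>r -` {x}. (r ^^ n) -` {y} \<inter> A). ennreal (?w (Suc n) u))"
    by (simp only: emeasure_P_coord[OF A])
  also have "\<dots> = (\<Sum>y\<in>r -` {x}. \<Sum>u\<in>(r ^^ n) -` {y} \<inter> A. ennreal (?w (Suc n) u))"
    using fiber finite_funpow_fiber by (intro sum.UNION_disjoint) auto
  also have "\<dots> = (\<Sum>y\<in>r -` {x}. \<Sum>u\<in>(r ^^ n) -` {y} \<inter> A. ennreal (W y) * ennreal (?w n u))"
    by (intro sum.cong refl) (auto simp: ennreal_mult'' W_nonneg prod_nonneg mult.commute)
  also have "\<dots> = (\<Sum>y\<in>r -` {x}. ennreal (W y) * emeasure (P y) {\<xi> \<in> solenoid r. \<xi> n \<in> A})"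
    by (simp add: emeasure_P_coord[OF A] sum_distrib_left)
  finally show ?thesis .
qed

lemma borel_measurable_P_coord:
  assumes A: "A \<in> sets borel"
  shows "(\<lambda>x. emeasure (P x) {\<xi> \<in> solenoid r. \<xi> n \<in> A}) \<in> borel_measurable borel"
proof (induction n)
  case 0
  then show ?case using A by (simp add: emeasure_P_0)
next
  case (Suc n)
  note Suc [measurable]
  have "(\<lambda>x. \<integral>\<^sup>+ y. ennreal ((cmod (m0 y))\<^sup>2) * emeasure (P y) {\<xi> \<in> solenoid r. \<xi> n \<in> A} \<partial>fiber_unif x)
      \<in> borel_measurable borel"
    by (rule measurable_compose[OF measurable_prob_algebraD[OF measurable_fiber_unif]
          nn_integral_measurable_subprob_algebra]) measurable
  then show ?case
    by (simp only: emeasure_P_Suc[OF A] sum_W_fiber_unif[OF Suc])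
qed

text \<open>Each \<open>P x\<close> is chosen separately, but its values on coordinate sets are
  determined and depend measurably on \<open>x\<close>; an intersection-stable generator is
  enough.\<close>

lemma measurable_P [measurable]: "P \<in> measurable borel (prob_algebra (sol_space r))"
proof (rule measurable_prob_algebra_generated[OF sets_sol_space Int_stable_coord_sets[OF r_measurable]])
  fix X assume "X \<in> coord_sets r"
  then show "(\<lambda>x. emeasure (P x) X) \<in> borel_measurable borel"
    by (elim coord_setE) (simp add: borel_measurable_P_coord)
qed (auto simp: prob_space_P coord_sets_def)

lemma measurable_P_mu: "P \<in> measurable \<mu> (subprob_algebra (sol_space r))"
  using measurable_prob_algebraD[OF measurable_P] by simp

section \<open>The measure on the solenoid and its transformation under \<open>r_inf\<close>\<close>

abbreviation M :: "(nat \<Rightarrow> 'a) measure" where "M \<equiv> mu_inf r m0 \<mu>"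

text \<open>Writing the explicit \<open>measure_of\<close> as a bind supplies countable additivity
  and the iterated integral.\<close>

lemma mu_inf_eq_bind: "M = \<mu> \<bind> P"
proof -
  have sets: "sets (\<mu> \<bind> P) = sets (sol_space r)" by (rule sets_bind) auto
  have "M = measure_of (space (sol_space r)) (sets (sol_space r)) (emeasure (\<mu> \<bind> P))"
    unfolding mu_inf_def
  proof (rule measure_of_eq)
    fix A assume "A \<in> sigma_sets (space (sol_space r)) (sets (sol_space r))"
    then have "A \<in> sets (sol_space r)" by (metis sets.sigma_sets_eq)
    then show "(\<integral>\<^sup>+ x. emeasure (P x) A \<partial>\<mu>) = emeasure (\<mu> \<bind> P) A"
      using measurable_P_mu by (subst emeasure_bind) auto
  qed (rule sets.space_closed)
  also have "\<dots> = \<mu> \<bind> P"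
    using measure_of_of_measure[of "\<mu> \<bind> P"] sets sets_eq_imp_space_eq[OF sets] by simp
  finally show ?thesis .
qed

lemma sets_M [simp, measurable_cong]: "sets M = sets (sol_space r)"
  unfolding mu_inf_eq_bind by (rule sets_bind) auto

lemma space_M [simp]: "space M = solenoid r"
  using sets_eq_imp_space_eq[OF sets_M] by simp

lemma measurable_M [simp]: "measurable M N = measurable (sol_space r) N"
  by (rule measurable_cong_sets[OF sets_M refl])

lemma nn_integral_M:
  "f \<in> borel_measurable (sol_space r) \<Longrightarrow> (\<integral>\<^sup>+ \<xi>. f \<xi> \<partial>M) = (\<integral>\<^sup>+ x. \<integral>\<^sup>+ \<xi>. f \<xi> \<partial>P x \<partial>\<mu>)"
  unfolding mu_inf_eq_bind by (rule nn_integral_bind[OF _ measurable_P_mu])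

lemma emeasure_M:
  "A \<in> sets (sol_space r) \<Longrightarrow> emeasure M A = (\<integral>\<^sup>+ x. emeasure (P x) A \<partial>\<mu>)"
  unfolding mu_inf_eq_bind by (subst emeasure_bind[OF _ measurable_P_mu]) auto

lemma prob_space_M: "prob_space M"
proof (rule prob_spaceI)
  have "solenoid r \<in> sets (sol_space r)" by (metis sets.top space_sol_space)
  then have "emeasure M (space M) = (\<integral>\<^sup>+ x. 1 \<partial>\<mu>)"
    using prob_space.emeasure_space_1[OF prob_space_P] by (simp add: emeasure_M)
  then show "emeasure M (space M) = 1" by (simp add: emeasure_space_1[simplified])
qed

text \<open>Under \<open>P x\<close> the coordinate 0 is almost surely \<open>x\<close>. Hence null
  sets of \<open>\<mu>\<close> pull back to null sets of \<open>M\<close>, and \<open>pi_op\<close>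
  respects almost-everywhere equality.\<close>

lemma distr_theta0: "distr M borel theta0 = \<mu>"
proof (rule measure_eqI)
  fix A assume "A \<in> sets (distr M borel theta0)"
  then have A [measurable]: "A \<in> sets borel" by simp
  have "theta0 -` A \<inter> solenoid r = {\<xi> \<in> space (sol_space r). \<xi> 0 \<in> A}" by (auto simp: theta0_def)
  moreover have "{\<xi> \<in> space (sol_space r). \<xi> 0 \<in> A} \<in> sets (sol_space r)" by measurable
  ultimately show "emeasure (distr M borel theta0) A = emeasure \<mu> A"
    using A by (simp add: emeasure_distr emeasure_M emeasure_P_0 sets_mu)
qed (simp add: sets_mu)

lemma AE_theta0:
  assumes "AE x in \<mu>. Q x"
  shows "AE \<xi> in M. Q (theta0 \<xi>)"
proof (rule AE_distrD[where f = theta0 and P = Q])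
  show "theta0 \<in> measurable M borel" by simp
  show "AE x in distr M borel theta0. Q x" unfolding distr_theta0 by (rule assms)
qed

text \<open>Since coordinate \<open>n\<close> is a function of coordinate \<open>n + 1\<close>, it suffices to test the coordinates after
  the first, where the recursion for the path measures applies.\<close>

lemma distr_density_r_inf:
  "distr (density M (\<lambda>\<xi>. ennreal ((cmod (m0 (theta0 \<xi>)))\<^sup>2))) (sol_space r) (r_inf r) = M"
    (is "?L = M")
proof (rule sol_measure_eqI[symmetric])
  let ?D = "\<lambda>\<xi>. ennreal ((cmod (m0 (theta0 \<xi>)))\<^sup>2)"
  have D [measurable]: "?D \<in> borel_measurable (sol_space r)" by measurable
  fix n and B :: "'a set" assume B [measurable]: "B \<in> sets borel"
  define A where "A = r -` B"
  have A [measurable]: "A \<in> sets borel"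
    unfolding A_def using measurable_sets_borel[OF r_measurable B] .
  have S: "{\<xi> \<in> solenoid r. \<xi> n \<in> B} = {\<xi> \<in> solenoid r. \<xi> (Suc n) \<in> A}"
    using coord_set_lift[of r n B 1] by (simp add: A_def)
  have m: "{\<xi> \<in> solenoid r. \<xi> k \<in> A} \<in> sets (sol_space r)" for k
    using measurable_sets[OF measurable_coord_sol A, of k r] by (simp add: vimage_def Int_def conj_commute)
  \<comment> \<open>\<open>r_inf\<close> inserts a new first entry, so coordinate
    \<open>Suc n\<close> of the image is coordinate \<open>n\<close> of the argument.\<close>
  have vim: "r_inf r -` {\<xi> \<in> solenoid r. \<xi> (Suc n) \<in> A} \<inter> solenoid r = {\<xi> \<in> solenoid r. \<xi> n \<in> A}"
    by (auto simp: r_inf_solenoid) (auto simp: r_inf_def)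
  note borel_measurable_P_coord[OF A, measurable]
  have "emeasure ?L {\<xi> \<in> solenoid r. \<xi> (Suc n) \<in> A}
      = (\<integral>\<^sup>+ \<xi>. ?D \<xi> * indicator {\<xi> \<in> solenoid r. \<xi> n \<in> A} \<xi> \<partial>M)"
    using m by (simp add: emeasure_distr emeasure_density vim del: vimage_Collect_eq)
  also have "\<dots> = (\<integral>\<^sup>+ x. \<integral>\<^sup>+ \<xi>. ?D \<xi> * indicator {\<xi> \<in> solenoid r. \<xi> n \<in> A} \<xi> \<partial>P x \<partial>\<mu>)"
    by (rule nn_integral_M[OF borel_measurable_times_ennreal[OF D borel_measurable_indicator[OF m]]])
  also have "\<dots> = (\<integral>\<^sup>+ x. ennreal ((cmod (m0 x))\<^sup>2) * emeasure (P x) {\<xi> \<in> solenoid r. \<xi> n \<in> A} \<partial>\<mu>)"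
  \<comment> \<open>Under \<open>P x\<close> the factor depending on \<open>theta0 \<xi>\<close> is
    almost surely the constant \<open>|m0 x|^2\<close>.\<close>
  proof (rule nn_integral_cong)
    fix x
    have "(\<integral>\<^sup>+ \<xi>. ?D \<xi> * indicator {\<xi> \<in> solenoid r. \<xi> n \<in> A} \<xi> \<partial>P x)
        = (\<integral>\<^sup>+ \<xi>. ennreal ((cmod (m0 x))\<^sup>2) * indicator {\<xi> \<in> solenoid r. \<xi> n \<in> A} \<xi> \<partial>P x)"
      by (rule nn_integral_cong_AE) (use AE_P_start[of x] in \<open>auto simp: theta0_def\<close>)
    then show "(\<integral>\<^sup>+ \<xi>. ?D \<xi> * indicator {\<xi> \<in> solenoid r. \<xi> n \<in> A} \<xi> \<partial>P x)
        = ennreal ((cmod (m0 x))\<^sup>2) * emeasure (P x) {\<xi> \<in> solenoid r. \<xi> n \<in> A}"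
      using m by (simp add: nn_integral_cmult_indicator)
  qed
  \<comment> \<open>Averaging over fibers leaves the integral over \<open>\<mu>\<close> unchanged,
    and the averaged integrand is the weighted sum in the recursion for \<open>P\<close>.\<close>
  also have "\<dots> = (\<integral>\<^sup>+ x. emeasure (P x) {\<xi> \<in> solenoid r. \<xi> (Suc n) \<in> A} \<partial>\<mu>)"
    by (subst nn_integral_mu_fiber)
      (auto simp: emeasure_P_Suc[OF A] sum_W_fiber_unif[OF borel_measurable_P_coord[OF A]])
  also have "\<dots> = emeasure M {\<xi> \<in> solenoid r. \<xi> (Suc n) \<in> A}"
    using m by (simp add: emeasure_M)
  finally show "emeasure M {\<xi> \<in> solenoid r. \<xi> n \<in> B} = emeasure ?L {\<xi> \<in> solenoid r. \<xi> n \<in> B}"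
    by (simp add: S)
qed (auto intro: prob_space.finite_measure prob_space_M)

lemma nn_integral_r_inf:
  assumes [measurable]: "g \<in> borel_measurable (sol_space r)"
  shows "(\<integral>\<^sup>+ \<xi>. ennreal ((cmod (m0 (theta0 \<xi>)))\<^sup>2) * g (r_inf r \<xi>) \<partial>M) = (\<integral>\<^sup>+ \<xi>. g \<xi> \<partial>M)"
  by (subst (2) distr_density_r_inf[symmetric]) (simp add: nn_integral_distr nn_integral_density)

section \<open>The wavelet representation\<close>

abbreviation U :: "((nat \<Rightarrow> 'a) \<Rightarrow> complex) \<Rightarrow> (nat \<Rightarrow> 'a) \<Rightarrow> complex" where "U \<equiv> U_op r m0"

abbreviation U_inv :: "((nat \<Rightarrow> 'a) \<Rightarrow> complex) \<Rightarrow> (nat \<Rightarrow> 'a) \<Rightarrow> complex" where "U_inv \<equiv> Uinv M U"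

sublocale M: prob_space M by (rule prob_space_M)

lemma measurable_funpow_r: "r ^^ n \<in> borel_measurable borel"
  by (rule measurable_compose_n[OF r_measurable])

lemma AE_m0: "AE \<xi> in M. m0 (theta0 \<xi>) \<noteq> 0"
proof (rule AE_theta0)
  have "{x. m0 x = 0} \<in> sets borel" by measurable
  then show "AE x in \<mu>. m0 x \<noteq> 0"
    using m0_nonsingular by (subst AE_iff_measurable[OF _ refl]) (auto simp: sets_mu)
qed

text \<open>The image identity controls preimages of null sets only where the density
  \<open>|m0|^2\<close> is positive; non-singularity makes this almost everywhere.\<close>

lemma AE_r_inf:
  assumes "AE \<xi> in M. Q \<xi>"
  shows "AE \<xi> in M. Q (r_inf r \<xi>)"
proof -
  let ?D = "density M (\<lambda>\<xi>. ennreal ((cmod (m0 (theta0 \<xi>)))\<^sup>2))"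
  have "AE \<xi> in distr ?D (sol_space r) (r_inf r). Q \<xi>"
    unfolding distr_density_r_inf by (rule assms)
  then have "AE \<xi> in ?D. Q (r_inf r \<xi>)"
    by (rule AE_distrD[rotated]) simp
  then have "AE \<xi> in M. 0 < ennreal ((cmod (m0 (theta0 \<xi>)))\<^sup>2) \<longrightarrow> Q (r_inf r \<xi>)"
    by (subst (asm) AE_density) auto
  with AE_m0 show ?thesis by eventually_elim auto
qed

text \<open>The weighted measure is absolutely continuous with respect to \<open>M\<close> and its
  image is \<open>M\<close>. Measurability of \<open>Q\<close> allows the statement to be pushed
  forward.\<close>

lemma AE_r_infD:
  assumes "AE \<xi> in M. Q (r_inf r \<xi>)" and [measurable]: "Measurable.pred (sol_space r) Q"
  shows "AE \<xi> in M. Q \<xi>"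
proof -
  let ?D = "density M (\<lambda>\<xi>. ennreal ((cmod (m0 (theta0 \<xi>)))\<^sup>2))"
  have "AE \<xi> in ?D. Q (r_inf r \<xi>)"
    by (subst AE_density) (use assms(1) in auto)
  moreover have "{\<xi> \<in> space (sol_space r). Q \<xi>} \<in> sets (sol_space r)" by measurable
  ultimately have "AE \<xi> in distr ?D (sol_space r) (r_inf r). Q \<xi>"
    by (subst AE_distr_iff) auto
  then show ?thesis unfolding distr_density_r_inf .
qed

section \<open>Unitarity of \<open>U\<close>\<close>

lemma U_measurable:
  assumes "f \<in> borel_measurable (sol_space r)"
  shows "U f \<in> borel_measurable (sol_space r)"
  unfolding U_op_def
  by (rule borel_measurable_times[OF measurable_compose[OF measurable_theta0 m0_measurable]
      measurable_compose[OF measurable_r_inf[OF r_measurable] assms]])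

lemma nn_integral_U:
  assumes [measurable]: "f \<in> borel_measurable (sol_space r)"
  shows "(\<integral>\<^sup>+ \<xi>. ennreal ((cmod (U f \<xi>))\<^sup>2) \<partial>M) = (\<integral>\<^sup>+ \<xi>. ennreal ((cmod (f \<xi>))\<^sup>2) \<partial>M)"
  using nn_integral_r_inf[of "\<lambda>\<xi>. ennreal ((cmod (f \<xi>))\<^sup>2)"]
  by (simp add: U_op_def norm_mult power_mult_distrib ennreal_mult')

lemma U_L2_iff: "f \<in> borel_measurable (sol_space r) \<Longrightarrow> U f \<in> L2set M \<longleftrightarrow> f \<in> L2set M"
  by (simp add: L2set_iff nn_integral_U U_measurable)

lemma U_L2: "f \<in> L2set M \<Longrightarrow> U f \<in> L2set M"
  using U_L2_iff[of f] L2set_measurable[of f M] by simp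

lemma L2_norm_U: "f \<in> L2set M \<Longrightarrow> L2_norm M (U f) = L2_norm M f"
  using L2set_measurable[of f M] by (simp add: L2_norm_nn_integral nn_integral_U U_measurable)

lemma U_AE_cong:
  assumes "AE \<xi> in M. f \<xi> = g \<xi>"
  shows "AE \<xi> in M. U f \<xi> = U g \<xi>"
  using AE_r_inf[OF assms] by eventually_elim (simp add: U_op_def)

lemma U_AE_inj:
  assumes "f \<in> L2set M" "g \<in> L2set M" "AE \<xi> in M. U f \<xi> = U g \<xi>"
  shows "AE \<xi> in M. f \<xi> = g \<xi>"
proof (rule AE_r_infD)
  have [measurable]: "f \<in> borel_measurable (sol_space r)" "g \<in> borel_measurable (sol_space r)"
    using L2set_measurable[OF assms(1)] L2set_measurable[OF assms(2)] by simp_all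
  have "Measurable.pred (sol_space r) (\<lambda>\<xi>. f \<xi> - g \<xi> \<in> {0})" by measurable
  then show "Measurable.pred (sol_space r) (\<lambda>\<xi>. f \<xi> = g \<xi>)" by simp
  show "AE \<xi> in M. f (r_inf r \<xi>) = g (r_inf r \<xi>)"
    using assms(3) AE_m0 by eventually_elim (simp add: U_op_def)
qed

text \<open>The left shift undoes \<open>r_inf\<close>, so the solution is the shifted quotient of
  \<open>g\<close> by \<open>m0\<close>. Division by zero affects only a null set.\<close>

lemma U_surj:
  assumes g: "g \<in> L2set M"
  obtains f where "f \<in> L2set M" "AE \<xi> in M. U f \<xi> = g \<xi>"
proof
  define f where "f \<xi> = g (\<lambda>n. \<xi> (Suc n)) / m0 (theta0 (\<lambda>n. \<xi> (Suc n)))" for \<xi>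
  have "g \<in> borel_measurable (sol_space r)" using L2set_measurable[OF g] by simp
  then have f [measurable]: "f \<in> borel_measurable (sol_space r)"
    unfolding f_def
    by (rule borel_measurable_divide[OF measurable_compose[OF measurable_shift]
        measurable_compose[OF measurable_shift measurable_compose[OF measurable_theta0 m0_measurable]]])
  show eq: "AE \<xi> in M. U f \<xi> = g \<xi>"
    using AE_m0 by eventually_elim (simp add: U_op_def f_def shift_r_inf)
  have "(\<integral>\<^sup>+ \<xi>. ennreal ((cmod (U f \<xi>))\<^sup>2) \<partial>M) = (\<integral>\<^sup>+ \<xi>. ennreal ((cmod (g \<xi>))\<^sup>2) \<partial>M)"
    by (rule nn_integral_cong_AE) (use eq in auto)
  \<comment> \<open>\<open>U\<close> preserves the extended integral of the squared modulus of any
    measurable function, so square-integrability of \<open>f\<close> can be read off from that of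
    \<open>U f\<close>.\<close>
  then have "U f \<in> L2set M" using g by (simp add: L2set_iff U_measurable[OF f])
  then show "f \<in> L2set M" by (simp add: U_L2_iff f)
qed

lemma unitary_U: "unitary_L2 M U"
  unfolding unitary_L2_def
proof (intro conjI ballI allI impI)
  fix g assume "g \<in> L2set M"
  then show "\<exists>f\<in>L2set M. AE \<xi> in M. U f \<xi> = g \<xi>" by (rule U_surj) blast
next
  fix f g a
  show "AE \<xi> in M. U (\<lambda>\<eta>. a * f \<eta> + g \<eta>) \<xi> = a * U f \<xi> + U g \<xi>"
    by (simp add: U_op_def algebra_simps)
next
  fix f g :: "(nat \<Rightarrow> 'a) \<Rightarrow> complex" assume "AE \<xi> in M. f \<xi> = g \<xi>"
  then show "AE \<xi> in M. U f \<xi> = U g \<xi>" by (rule U_AE_cong)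
qed (auto intro: U_L2 L2_norm_U)

lemma U_inv:
  assumes "g \<in> L2set M"
  shows "U_inv g \<in> L2set M" "AE \<xi> in M. U (U_inv g) \<xi> = g \<xi>"
proof -
  have "\<exists>f. f \<in> L2set M \<and> (AE \<xi> in M. U f \<xi> = g \<xi>)"
    by (rule U_surj[OF assms]) blast
  from someI_ex[OF this] show "U_inv g \<in> L2set M" "AE \<xi> in M. U (U_inv g) \<xi> = g \<xi>"
    unfolding Uinv_def by auto
qed

text \<open>Since \<open>theta0 (r_inf r \<xi>)\<close> is \<open>r (theta0 \<xi>)\<close>, the
  multiplier \<open>f\<close> leaves \<open>U\<close> as \<open>f \<circ> r\<close>, and what
  remains is \<open>U (U_inv g)\<close>.\<close>

lemma covariance:
  assumes "g \<in> L2set M"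
  shows "AE \<xi> in M. U (pi_op f (U_inv g)) \<xi> = pi_op (f \<circ> r) g \<xi>"
  using U_inv(2)[OF assms]
  by eventually_elim (simp add: U_op_def pi_op_def theta0_def r_inf_def mult.left_commute)

lemma Linf_theta0:
  assumes "f \<in> Linf_set \<mu>"
  shows "(\<lambda>\<xi>. f (theta0 \<xi>)) \<in> borel_measurable M" "\<exists>C. AE \<xi> in M. cmod (f (theta0 \<xi>)) \<le> C"
  using assms AE_theta0[of "\<lambda>x. cmod (f x) \<le> C" for C]
  by (auto simp: Linf_set_def intro: measurable_compose[OF measurable_theta0])

lemma representation_pi: "representation_Linf \<mu> M pi_op"
  unfolding representation_Linf_def
proof (intro conjI ballI allI impI)
  fix f g assume f: "f \<in> Linf_set \<mu>" and g: "g \<in> L2set M"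
  show "pi_op f g \<in> L2set M"
    using Linf_theta0[OF f] L2set_mult_bounded(1)[OF _ _ g] unfolding pi_op_def by blast
next
  fix f assume f: "f \<in> Linf_set \<mu>"
  then obtain C where "AE \<xi> in M. cmod (f (theta0 \<xi>)) \<le> C" using Linf_theta0(2) by blast
  from L2set_mult_bounded(2)[OF Linf_theta0(1)[OF f] this]
  show "\<exists>C. \<forall>g\<in>L2set M. L2_norm M (pi_op f g) \<le> C * L2_norm M g"
    unfolding pi_op_def by blast
next
  fix f f' :: "'a \<Rightarrow> complex" and g :: "(nat \<Rightarrow> 'a) \<Rightarrow> complex" assume "AE x in \<mu>. f x = f' x"
  from AE_theta0[OF this] show "AE \<xi> in M. pi_op f g \<xi> = pi_op f' g \<xi>"
    by eventually_elim (simp add: pi_op_def)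
next
  fix f :: "'a \<Rightarrow> complex" and g g' :: "(nat \<Rightarrow> 'a) \<Rightarrow> complex" assume "AE \<xi> in M. g \<xi> = g' \<xi>"
  then show "AE \<xi> in M. pi_op f g \<xi> = pi_op f g' \<xi>"
    by eventually_elim (simp add: pi_op_def)
qed (simp_all add: pi_op_def L2_inner_def algebra_simps)

lemma orthogonality:
  assumes "f \<in> Linf_set \<mu>"
  shows "L2_inner M (pi_op f phi) phi = (\<integral>x. f x \<partial>\<mu>)"
proof -
  have "(\<integral>\<xi>. f (theta0 \<xi>) \<partial>M) = (\<integral>x. f x \<partial>distr M borel theta0)"
    using assms by (intro integral_distr[symmetric]) (auto simp: Linf_set_def)
  then show ?thesis by (simp add: L2_inner_def pi_op_def phi_def distr_theta0)
qed

text \<open>\<open>U_inv\<close> picks some representative, so equality holds only almost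
  everywhere. The induction cancels the inner \<open>n\<close> pairs around \<open>U F\<close> and
  then removes the last \<open>U\<close> by injectivity.\<close>

lemma U_inv_funpow:
  assumes "F \<in> L2set M"
  shows "(U_inv ^^ n) ((U ^^ n) F) \<in> L2set M \<and> (AE \<xi> in M. (U_inv ^^ n) ((U ^^ n) F) \<xi> = F \<xi>)"
  using assms
proof (induction n arbitrary: F)
  case (Suc n)
  define q where "q = (U_inv ^^ n) ((U ^^ n) (U F))"
  have q: "q \<in> L2set M" "AE \<xi> in M. q \<xi> = U F \<xi>"
    using Suc.IH[OF U_L2[OF Suc.prems]] by (auto simp: q_def)
  have "AE \<xi> in M. U (U_inv q) \<xi> = U F \<xi>"
    using U_inv(2)[OF q(1)] q(2) by eventually_elim simp
  then have "AE \<xi> in M. U_inv q \<xi> = F \<xi>"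
    by (rule U_AE_inj[OF U_inv(1)[OF q(1)] Suc.prems])
  then show ?case
    using U_inv(1)[OF q(1)] by (simp add: q_def funpow_swap1)
qed simp

text \<open>The factors form a cocycle in coordinate 0. As \<open>r_inf ^^ n\<close> moves
  coordinate 0 to position \<open>n\<close>, a function of coordinate \<open>n\<close> becomes a
  function of \<open>\<xi> 0\<close> alone.\<close>

lemma U_funpow: "(U ^^ n) F \<xi> = (\<Prod>k<n. m0 ((r ^^ k) (\<xi> 0))) * F ((r_inf r ^^ n) \<xi>)"
proof (induction n arbitrary: F)
  case (Suc n)
  have "(U ^^ Suc n) F \<xi> = (U ^^ n) (U F) \<xi>" by (simp add: funpow_swap1)
  also have "\<dots> = (\<Prod>k<n. m0 ((r ^^ k) (\<xi> 0))) * U F ((r_inf r ^^ n) \<xi>)" by (rule Suc)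
  also have "U F ((r_inf r ^^ n) \<xi>) = m0 ((r ^^ n) (\<xi> 0)) * F ((r_inf r ^^ Suc n) \<xi>)"
    by (simp add: U_op_def theta0_funpow_r_inf)
  finally show ?case by simp
qed simp

text \<open>Every coordinate is a function of any later one, so on the solenoid the functions of a single
  coordinate already exhaust the functions of finitely many coordinates.\<close>

definition coord_approx :: "((nat \<Rightarrow> 'a) \<Rightarrow> complex) \<Rightarrow> bool" where
  "coord_approx g \<longleftrightarrow> g \<in> L2set M \<and> (\<forall>\<epsilon>>0. \<exists>n h. h \<in> borel_measurable borel \<and> bounded (range h) \<and>
     (\<integral>\<xi>. (cmod (g \<xi> - h (\<xi> n)))\<^sup>2 \<partial>M) < \<epsilon>)"

lemma coord_fun_L2:
  fixes h :: "'a \<Rightarrow> complex"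
  assumes "h \<in> borel_measurable borel" "bounded (range h)"
  shows "(\<lambda>\<xi>. h (\<xi> n)) \<in> L2set M"
proof -
  obtain C where "\<And>x. cmod (h x) \<le> C" using assms(2) by (auto simp: bounded_iff)
  then show ?thesis
    using assms(1) by (intro M.L2set_bounded[of _ C]) auto
qed

lemma coord_approxD:
  assumes "coord_approx g" "\<epsilon> > 0"
  obtains n h where "h \<in> borel_measurable borel" "bounded (range h)"
    "(\<integral>\<xi>. (cmod (g \<xi> - h (\<xi> n)))\<^sup>2 \<partial>M) < \<epsilon>"
  using assms unfolding coord_approx_def by blast

lemma coord_approx_cong:
  assumes "coord_approx f" "\<And>\<xi>. \<xi> \<in> solenoid r \<Longrightarrow> f \<xi> = g \<xi>"
  shows "coord_approx g"
proof -
  have "g \<in> L2set M" using assms L2set_cong[of M f g] by (simp add: coord_approx_def)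
  moreover have "(\<integral>\<xi>. (cmod (g \<xi> - h (\<xi> n)))\<^sup>2 \<partial>M) = (\<integral>\<xi>. (cmod (f \<xi> - h (\<xi> n)))\<^sup>2 \<partial>M)" for h n
    using assms(2) by (intro Bochner_Integration.integral_cong) auto
  ultimately show ?thesis using assms(1) by (simp add: coord_approx_def)
qed

lemma coord_approx_add:
  assumes f: "coord_approx f" and g: "coord_approx g"
  shows "coord_approx (\<lambda>\<xi>. f \<xi> + g \<xi>)"
  unfolding coord_approx_def
proof (intro conjI allI impI)
  have L2: "f \<in> L2set M" "g \<in> L2set M" using f g by (auto simp: coord_approx_def)
  then show "(\<lambda>\<xi>. f \<xi> + g \<xi>) \<in> L2set M" by (rule L2set_add)
  fix \<epsilon> :: real assume "\<epsilon> > 0"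
  then have "\<epsilon> / 4 > 0" by simp
  from coord_approxD[OF f this] obtain n h where
    h [measurable]: "h \<in> borel_measurable borel" "bounded (range h)"
    "(\<integral>\<xi>. (cmod (f \<xi> - h (\<xi> n)))\<^sup>2 \<partial>M) < \<epsilon> / 4" .
  from coord_approxD[OF g \<open>\<epsilon> / 4 > 0\<close>] obtain m k where
    k [measurable]: "k \<in> borel_measurable borel" "bounded (range k)"
    "(\<integral>\<xi>. (cmod (g \<xi> - k (\<xi> m)))\<^sup>2 \<partial>M) < \<epsilon> / 4" .
  \<comment> \<open>Both approximants are rewritten as functions of the common coordinate
    \<open>n + m\<close>.\<close>
  define l where "l x = h ((r ^^ m) x) + k ((r ^^ n) x)" for x
  have "l \<in> borel_measurable borel"
    unfolding l_def
    by (rule borel_measurable_add[OF measurable_compose[OF measurable_funpow_r h(1)]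
        measurable_compose[OF measurable_funpow_r k(1)]])
  moreover have "bounded (range l)"
  proof -
    obtain A B where "\<And>x. cmod (h x) \<le> A" "\<And>x. cmod (k x) \<le> B"
      using h(2) k(2) by (auto simp: bounded_iff)
    then have "cmod (l x) \<le> A + B" for x
      unfolding l_def by (intro norm_triangle_mono)
    then show ?thesis by (auto simp: bounded_iff)
  qed
  moreover have "(\<integral>\<xi>. (cmod (f \<xi> + g \<xi> - l (\<xi> (n + m))))\<^sup>2 \<partial>M)
      = (\<integral>\<xi>. (cmod ((f \<xi> - h (\<xi> n)) + (g \<xi> - k (\<xi> m))))\<^sup>2 \<partial>M)"
  proof (intro Bochner_Integration.integral_cong refl)
    fix \<xi> assume "\<xi> \<in> space M"
    then have "(r ^^ m) (\<xi> (n + m)) = \<xi> n" "(r ^^ n) (\<xi> (n + m)) = \<xi> m"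
      using funpow_solenoid[of \<xi> r m n] funpow_solenoid[of \<xi> r n m] by (auto simp: add.commute)
    then show "(cmod (f \<xi> + g \<xi> - l (\<xi> (n + m))))\<^sup>2 = (cmod ((f \<xi> - h (\<xi> n)) + (g \<xi> - k (\<xi> m))))\<^sup>2"
      by (simp add: l_def algebra_simps)
  qed
  then have "(\<integral>\<xi>. (cmod (f \<xi> + g \<xi> - l (\<xi> (n + m))))\<^sup>2 \<partial>M) < \<epsilon>"
    using L2set_add(2)[OF L2set_diff[OF L2(1) coord_fun_L2[OF h(1,2), of n]]
        L2set_diff[OF L2(2) coord_fun_L2[OF k(1,2), of m]]] h(3) k(3) by linarith
  ultimately show "\<exists>n h. h \<in> borel_measurable borel \<and> bounded (range h) \<and>
      (\<integral>\<xi>. (cmod (f \<xi> + g \<xi> - h (\<xi> n)))\<^sup>2 \<partial>M) < \<epsilon>"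
    by blast
qed

lemma coord_approx_cmult:
  assumes f: "coord_approx f"
  shows "coord_approx (\<lambda>\<xi>. c * f \<xi>)"
  unfolding coord_approx_def
proof (intro conjI allI impI)
  show "(\<lambda>\<xi>. c * f \<xi>) \<in> L2set M" using f by (auto simp: coord_approx_def intro: L2set_cmult)
  fix \<epsilon> :: real assume e: "\<epsilon> > 0"
  \<comment> \<open>The added 1 keeps the divisor positive when \<open>c\<close> is 0.\<close>
  have c: "(cmod c)\<^sup>2 + 1 > 0" by (simp add: add_nonneg_pos)
  then have "\<epsilon> / ((cmod c)\<^sup>2 + 1) > 0" using e by simp
  from coord_approxD[OF f this] obtain n h where
    h [measurable]: "h \<in> borel_measurable borel" "bounded (range h)"
    and lt: "(\<integral>\<xi>. (cmod (f \<xi> - h (\<xi> n)))\<^sup>2 \<partial>M) < \<epsilon> / ((cmod c)\<^sup>2 + 1)" (is "?I < _") .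
  have "bounded (range (\<lambda>x. c * h x))"
    using bounded_linear_image[OF h(2) bounded_linear_mult_right[of c]] by (simp add: image_image)
  have "(\<integral>\<xi>. (cmod (c * f \<xi> - c * h (\<xi> n)))\<^sup>2 \<partial>M) = (cmod c)\<^sup>2 * ?I"
    by (simp add: norm_mult power_mult_distrib flip: right_diff_distrib)
  also have "\<dots> \<le> ((cmod c)\<^sup>2 + 1) * ?I" by (intro mult_right_mono) auto
  also have "\<dots> < \<epsilon>" using lt c by (simp add: field_simps)
  finally show "\<exists>n h. h \<in> borel_measurable borel \<and> bounded (range h) \<and>
      (\<integral>\<xi>. (cmod (c * f \<xi> - h (\<xi> n)))\<^sup>2 \<partial>M) < \<epsilon>"
    using \<open>bounded (range (\<lambda>x. c * h x))\<close> by (intro exI[of _ n] exI[of _ "\<lambda>x. c * h x"]) auto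
qed

text \<open>Dominated convergence gives mean-square convergence, so some \<open>F i\<close> is close
  to \<open>g\<close> and its own approximant serves for \<open>g\<close>. The factor 2 in the bound
  is the one that simple approximation provides.\<close>

lemma coord_approx_limit:
  assumes F: "\<And>i. coord_approx (F i)" and g: "g \<in> L2set M"
    and lim: "\<And>\<xi>. \<xi> \<in> solenoid r \<Longrightarrow> (\<lambda>i. F i \<xi>) \<longlonglongrightarrow> g \<xi>"
    and bound: "\<And>i \<xi>. \<xi> \<in> solenoid r \<Longrightarrow> cmod (F i \<xi>) \<le> 2 * cmod (g \<xi>)"
  shows "coord_approx g"
  unfolding coord_approx_def
proof (intro conjI allI impI g)
  fix \<epsilon> :: real assume e: "\<epsilon> > 0"
  have F_L2: "F i \<in> L2set M" for i using F by (simp add: coord_approx_def)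
  have [measurable]: "g \<in> borel_measurable (sol_space r)" "F i \<in> borel_measurable (sol_space r)" for i
    using L2set_measurable[OF g] L2set_measurable[OF F_L2] by simp_all
  have "(\<lambda>i. \<integral>\<xi>. (cmod (g \<xi> - F i \<xi>))\<^sup>2 \<partial>M) \<longlonglongrightarrow> (\<integral>\<xi>. 0 \<partial>M)"
  \<comment> \<open>The constant 9 is the square of 1 + 2, from the triangle inequality and the
    bound on \<open>F i\<close>.\<close>
  proof (rule integral_dominated_convergence[where w = "\<lambda>\<xi>. 9 * (cmod (g \<xi>))\<^sup>2"])
    show "integrable M (\<lambda>\<xi>. 9 * (cmod (g \<xi>))\<^sup>2)" using g by (simp add: L2set_def)
    show "AE \<xi> in M. (\<lambda>i. (cmod (g \<xi> - F i \<xi>))\<^sup>2) \<longlonglongrightarrow> 0"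
    proof (rule AE_I2)
      fix \<xi> assume "\<xi> \<in> space M"
      then have "(\<lambda>i. (cmod (g \<xi> - F i \<xi>))\<^sup>2) \<longlonglongrightarrow> (cmod (g \<xi> - g \<xi>))\<^sup>2"
        by (intro tendsto_intros lim) simp
      then show "(\<lambda>i. (cmod (g \<xi> - F i \<xi>))\<^sup>2) \<longlonglongrightarrow> 0" by simp
    qed
    show "AE \<xi> in M. norm ((cmod (g \<xi> - F i \<xi>))\<^sup>2) \<le> 9 * (cmod (g \<xi>))\<^sup>2" for i
    proof (rule AE_I2)
      fix \<xi> assume "\<xi> \<in> space M"
      then have "cmod (g \<xi> - F i \<xi>) \<le> 3 * cmod (g \<xi>)"
        using norm_triangle_ineq4[of "g \<xi>" "F i \<xi>"] bound[of \<xi> i] by simp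
      then have "(cmod (g \<xi> - F i \<xi>))\<^sup>2 \<le> (3 * cmod (g \<xi>))\<^sup>2" by (intro power_mono) auto
      then show "norm ((cmod (g \<xi> - F i \<xi>))\<^sup>2) \<le> 9 * (cmod (g \<xi>))\<^sup>2" by (simp add: power_mult_distrib)
    qed
  qed simp_all
  then have "eventually (\<lambda>i. (\<integral>\<xi>. (cmod (g \<xi> - F i \<xi>))\<^sup>2 \<partial>M) < \<epsilon> / 4) sequentially"
    using e by (intro order_tendstoD(2)) auto
  then obtain i where i: "(\<integral>\<xi>. (cmod (g \<xi> - F i \<xi>))\<^sup>2 \<partial>M) < \<epsilon> / 4"
    by (auto simp: eventually_sequentially)
  from e have "\<epsilon> / 4 > 0" by simp
  from coord_approxD[OF F this] obtain n h where
    h: "h \<in> borel_measurable borel" "bounded (range h)"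
    "(\<integral>\<xi>. (cmod (F i \<xi> - h (\<xi> n)))\<^sup>2 \<partial>M) < \<epsilon> / 4" .
  have "(\<integral>\<xi>. (cmod (g \<xi> - h (\<xi> n)))\<^sup>2 \<partial>M) < \<epsilon>"
    using L2set_add(2)[OF L2set_diff[OF g F_L2[of i]]
        L2set_diff[OF F_L2[of i] coord_fun_L2[OF h(1,2), of n]]] i h(3)
    by simp
  then show "\<exists>n h. h \<in> borel_measurable borel \<and> bounded (range h) \<and>
      (\<integral>\<xi>. (cmod (g \<xi> - h (\<xi> n)))\<^sup>2 \<partial>M) < \<epsilon>"
    using h by blast
qed

lemma coord_approx_coord_set:
  assumes "A \<in> sets borel"
  shows "coord_approx (indicator {\<xi> \<in> solenoid r. \<xi> n \<in> A})"
proof -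
  have h: "(indicator A :: 'a \<Rightarrow> complex) \<in> borel_measurable borel"
    "bounded (range (indicator A :: 'a \<Rightarrow> complex))"
    using assms by (auto simp: bounded_iff indicator_def intro!: exI[of _ 1])
  have eq: "indicator A (\<xi> n) = (indicator {\<xi> \<in> solenoid r. \<xi> n \<in> A} \<xi> :: complex)"
    if "\<xi> \<in> solenoid r" for \<xi> using that by (simp add: indicator_def)
  have "coord_approx (\<lambda>\<xi>. indicator A (\<xi> n))"
    unfolding coord_approx_def
  proof (intro conjI allI impI)
    fix \<epsilon> :: real assume "\<epsilon> > 0"
    then show "\<exists>m h. h \<in> borel_measurable borel \<and> bounded (range h) \<and>
        (\<integral>\<xi>. (cmod (indicator A (\<xi> n) - h (\<xi> m)))\<^sup>2 \<partial>M) < \<epsilon>"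
      using h by (intro exI[of _ n] exI[of _ "indicator A"]) simp
  qed (rule coord_fun_L2[OF h])
  then show ?thesis by (rule coord_approx_cong) (rule eq)
qed

text \<open>Dynkin induction: approximability passes from coordinate sets to complements by
  linearity and to countable disjoint unions by limits.\<close>

lemma coord_approx_indicator:
  assumes "S \<in> sets (sol_space r)"
  shows "coord_approx (indicator S)"
proof -
  have sub: "coord_sets r \<subseteq> Pow (solenoid r)" by (auto simp: coord_sets_def)
  have "S \<in> sigma_sets (solenoid r) (coord_sets r)"
    using assms by (simp add: sets_sol_space)
  with Int_stable_coord_sets[OF r_measurable] sub show ?thesis
  proof (induction rule: sigma_sets_induct_disjoint)
    case (basic X)
    then show ?case by (elim coord_setE) (simp add: coord_approx_coord_set)
  next
    case empty
    show ?case by (rule coord_approx_cong[OF coord_approx_coord_set[of "{}" 0]]) simp_all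
  next
    case (compl X)
    have "coord_approx (\<lambda>\<xi>. indicator {\<xi> \<in> solenoid r. \<xi> 0 \<in> UNIV} \<xi> + (- 1) * indicator X \<xi>)"
      by (intro coord_approx_add coord_approx_cmult coord_approx_coord_set compl) simp
    then show ?case by (rule coord_approx_cong) (auto simp: indicator_def)
  next
    case (union A)
    have meas: "A i \<in> sets (sol_space r)" for i
      using union(2) by (auto simp: sets_sol_space)
    \<comment> \<open>Disjointness turns the indicator of a finite union into a sum, to which
      closure under addition applies.\<close>
    have part: "coord_approx (indicator (\<Union>i<k. A i))" for k
    proof (induction k)
      case 0
      show ?case by (rule coord_approx_cong[OF coord_approx_coord_set[of "{}" 0]]) simp_all
    next
      case (Suc k)
      have "coord_approx (\<lambda>\<xi>. indicator (\<Union>i<k. A i) \<xi> + indicator (A k) \<xi>)"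
        using Suc union by (intro coord_approx_add) auto
      moreover have "A i \<inter> A k = {}" if "i < k" for i
        using union(1) that by (intro disjoint_family_onD[OF union(1)]) auto
      then have "indicator (\<Union>i<k. A i) \<xi> + indicator (A k) \<xi> = (indicator (\<Union>i<Suc k. A i) \<xi> :: complex)" for \<xi>
        unfolding lessThan_Suc by (auto simp: indicator_def)
      ultimately show ?case by simp
    qed
    show ?case
    proof (rule coord_approx_limit[OF part])
      show "indicator (\<Union>i. A i) \<in> L2set M"
        using meas by (intro M.L2set_bounded[of _ 1]) (auto simp: indicator_def)
      show "(\<lambda>k. indicator (\<Union>i<k. A i) \<xi> :: complex) \<longlonglongrightarrow> indicator (\<Union>i. A i) \<xi>" for \<xi>
        by (rule LIMSEQ_indicator_UN)
      show "cmod (indicator (\<Union>i<k. A i) \<xi>) \<le> 2 * cmod (indicator (\<Union>i. A i) \<xi>)" for k \<xi>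
        by (auto simp: indicator_def)
    qed
  qed
qed

lemma coord_approx_L2:
  assumes g: "g \<in> L2set M"
  shows "coord_approx g"
proof -
  have "g \<in> borel_measurable M" using g by (rule L2set_measurable)
  \<comment> \<open>The base point 0 makes the simple approximants bounded by
    \<open>2 * cmod (g \<xi>)\<close>.\<close>
  from borel_measurable_implies_sequence_metric[OF this, of 0] obtain F where
    simple: "\<And>i. simple_function M (F i)"
    and lim: "\<And>\<xi>. \<xi> \<in> space M \<Longrightarrow> (\<lambda>i. F i \<xi>) \<longlonglongrightarrow> g \<xi>"
    and bound: "\<And>i \<xi>. \<xi> \<in> space M \<Longrightarrow> dist (F i \<xi>) 0 \<le> 2 * dist (g \<xi>) 0"
    by blast
  have "coord_approx (F i)" for i
  proof -
    let ?S = "\<lambda>y. F i -` {y} \<inter> space M"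
    have "coord_approx (\<lambda>\<xi>. \<Sum>y\<in>Y. y * indicator (?S y) \<xi>)" if "finite Y" for Y
      using that
    proof (induction Y rule: finite_induct)
      case empty
      show ?case by (rule coord_approx_cong[OF coord_approx_coord_set[of "{}" 0]]) simp_all
    next
      case (insert y Y)
      have "?S y \<in> sets (sol_space r)"
        using simple_functionD(2)[OF simple, of i "{y}"] by simp
      then have "coord_approx (\<lambda>\<xi>. y * indicator (?S y) \<xi> + (\<Sum>y\<in>Y. y * indicator (?S y) \<xi>))"
        using insert.IH by (intro coord_approx_add coord_approx_cmult coord_approx_indicator)
      then show ?case unfolding sum.insert[OF insert.hyps] .
    qed
    from this[OF simple_functionD(1)[OF simple, of i]] show ?thesis
    proof (rule coord_approx_cong)
      fix \<xi> assume "\<xi> \<in> solenoid r"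
      then have "F i \<xi> = (\<Sum>y\<in>F i ` space M. indicator (?S y) \<xi> *\<^sub>R y)"
        by (intro simple_function_indicator_representation_banach[OF simple]) simp
      also have "\<dots> = (\<Sum>y\<in>F i ` space M. y * indicator (?S y) \<xi>)"
        by (intro sum.cong refl) (simp add: indicator_def)
      finally show "(\<Sum>y\<in>F i ` space M. y * indicator (?S y) \<xi>) = F i \<xi>" ..
    qed
  qed
  then show ?thesis
    by (rule coord_approx_limit[OF _ g]) (use lim bound in auto)
qed

section \<open>Filter products and density\<close>

lemma AE_mu_r:
  assumes "AE x in \<mu>. Q x"
  shows "AE x in \<mu>. Q (r x)"
proof (rule AE_distrD[where f = r and P = Q])
  show "r \<in> measurable \<mu> borel" by (simp add: r_measurable)
  show "AE x in distr \<mu> borel r. Q x" unfolding distr_mu_r by (rule assms)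
qed

lemma Linf_filter_product:
  assumes "h \<in> borel_measurable borel" "bounded (range h)"
  shows "(\<lambda>x. (\<Prod>k<n. m0 ((r ^^ k) x)) * h x) \<in> Linf_set \<mu>"
proof -
  obtain B where B: "\<And>x. cmod (h x) \<le> B" using assms(2) by (auto simp: bounded_iff)
  obtain C where C: "AE x in \<mu>. cmod (m0 x) \<le> C" using m0_Linf by (auto simp: Linf_set_def)
  \<comment> \<open>\<open>m0\<close> is bounded only almost everywhere; invariance of
    \<open>\<mu>\<close> under \<open>r\<close> carries the bound to every iterate.\<close>
  have shifted: "AE x in \<mu>. cmod (m0 ((r ^^ k) x)) \<le> C" for k
  proof (induction k)
    case (Suc k)
    from AE_mu_r[where Q = "\<lambda>x. cmod (m0 ((r ^^ k) x)) \<le> C", OF Suc]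
    show ?case by (simp only: funpow_Suc_right comp_apply)
  qed (use C in simp)
  have "AE x in \<mu>. \<forall>k\<in>{..<n}. cmod (m0 ((r ^^ k) x)) \<le> C"
    by (intro AE_finite_allI shifted) auto
  then have "AE x in \<mu>. cmod ((\<Prod>k<n. m0 ((r ^^ k) x)) * h x) \<le> \<bar>C\<bar> ^ n * \<bar>B\<bar>"
  proof eventually_elim
    case (elim x)
    have "(\<Prod>k<n. cmod (m0 ((r ^^ k) x))) \<le> (\<Prod>k<n. \<bar>C\<bar>)"
      using elim by (intro prod_mono) (auto intro: order_trans[OF _ abs_ge_self])
    moreover have "cmod (h x) \<le> \<bar>B\<bar>" using B[of x] by linarith
    ultimately show ?case by (auto simp: norm_mult simp flip: prod_norm intro!: mult_mono)
  qed
  moreover have "(\<lambda>x. (\<Prod>k<n. m0 ((r ^^ k) x)) * h x) \<in> borel_measurable borel"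
    by (rule borel_measurable_times[OF borel_measurable_prod assms(1)])
      (rule measurable_compose[OF measurable_funpow_r m0_measurable])
  ultimately show ?thesis by (auto simp: Linf_set_def)
qed

lemma dense_U_inv_pi_phi:
  assumes g: "g \<in> L2set M" and "\<epsilon> > 0"
  shows "\<exists>n. \<exists>f\<in>Linf_set \<mu>. L2_norm M (\<lambda>\<xi>. g \<xi> - (U_inv ^^ n) (pi_op f phi) \<xi>) < \<epsilon>"
proof -
  \<comment> \<open>The approximation is in mean square, while \<open>L2_norm\<close> takes a square
    root.\<close>
  have "\<epsilon>\<^sup>2 > 0" using assms by simp
  from coord_approxD[OF coord_approx_L2[OF g] this] obtain n h where
    h: "h \<in> borel_measurable borel" "bounded (range h)"
    and lt: "(\<integral>\<xi>. (cmod (g \<xi> - h (\<xi> n)))\<^sup>2 \<partial>M) < \<epsilon>\<^sup>2" .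
  define H where "H = (\<lambda>\<xi>::nat \<Rightarrow> 'a. h (\<xi> n))"
  define f where "f x = (\<Prod>k<n. m0 ((r ^^ k) x)) * h x" for x
  have H: "H \<in> L2set M" unfolding H_def by (rule coord_fun_L2[OF h])
  \<comment> \<open>This explains the choice of \<open>f\<close>: undoing \<open>U\<close>
    \<open>n\<close> times on \<open>pi_op f phi\<close> returns the approximant \<open>H\<close> up
    to a null set.\<close>
  have "(U ^^ n) H = pi_op f phi"
    by (auto simp: fun_eq_iff U_funpow pi_op_def phi_def f_def H_def theta0_def
        funpow_r_inf_add[where k = 0, simplified])
  with U_inv_funpow[OF H, of n]
  have L2: "(U_inv ^^ n) (pi_op f phi) \<in> L2set M"
    and eq: "AE \<xi> in M. (U_inv ^^ n) (pi_op f phi) \<xi> = H \<xi>" by auto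
  have "(\<integral>\<xi>. (cmod (g \<xi> - (U_inv ^^ n) (pi_op f phi) \<xi>))\<^sup>2 \<partial>M) = (\<integral>\<xi>. (cmod (g \<xi> - H \<xi>))\<^sup>2 \<partial>M)"
  proof (rule integral_cong_AE)
    show "AE \<xi> in M. (cmod (g \<xi> - (U_inv ^^ n) (pi_op f phi) \<xi>))\<^sup>2 = (cmod (g \<xi> - H \<xi>))\<^sup>2"
      using eq by eventually_elim simp
  qed (use L2set_diff[OF g L2] L2set_diff[OF g H] in \<open>auto simp: L2set_def simp del: measurable_M dest: borel_measurable_integrable\<close>)
  also have "\<dots> < \<epsilon>\<^sup>2" using lt by (simp add: H_def)
  finally have "L2_norm M (\<lambda>\<xi>. g \<xi> - (U_inv ^^ n) (pi_op f phi) \<xi>) < \<epsilon>"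
    unfolding L2_norm_def using \<open>\<epsilon> > 0\<close> by (simp add: real_less_lsqrt)
  moreover have "f \<in> Linf_set \<mu>" unfolding f_def by (rule Linf_filter_product[OF h])
  ultimately show ?thesis by blast
qed

end

theorem theorem2p2:
  fixes r :: "'a::metric_space \<Rightarrow> 'a" and \<mu> :: "'a measure" and m0 :: "'a \<Rightarrow> complex"
  assumes "compact (UNIV :: 'a set)"
    and "r \<in> borel_measurable borel"
    and "\<forall>x. r -` {x} \<noteq> {} \<and> finite (r -` {x})"
    and "prob_space \<mu>" and "sets \<mu> = sets borel"
    and "\<forall>f :: 'a \<Rightarrow> complex. continuous_on UNIV f \<longrightarrow>
           (\<integral>x. f x \<partial>\<mu>) = (\<integral>x. (1 / of_nat (card (r -` {x}))) * (\<Sum>y\<in>r -` {x}. f y) \<partial>\<mu>)"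
    and "m0 \<in> Linf_set \<mu>"
    and "\<forall>x. (1 / real (card (r -` {x}))) * (\<Sum>y\<in>r -` {x}. (cmod (m0 y))\<^sup>2) = 1"
    and "emeasure \<mu> {x. m0 x = 0} = 0"
  shows "unitary_L2 (mu_inf r m0 \<mu>) (U_op r m0)
    \<and> representation_Linf \<mu> (mu_inf r m0 \<mu>) pi_op
    \<and> (\<forall>f\<in>Linf_set \<mu>. \<forall>g\<in>L2set (mu_inf r m0 \<mu>).
          AE \<xi> in mu_inf r m0 \<mu>.
            U_op r m0 (pi_op f (Uinv (mu_inf r m0 \<mu>) (U_op r m0) g)) \<xi> = pi_op (f \<circ> r) g \<xi>)
    \<and> (AE \<xi> in mu_inf r m0 \<mu>. U_op r m0 phi \<xi> = pi_op m0 phi \<xi>)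
    \<and> (\<forall>f\<in>Linf_set \<mu>. L2_inner (mu_inf r m0 \<mu>) (pi_op f phi) phi = (\<integral>x. f x \<partial>\<mu>))
    \<and> (\<forall>g\<in>L2set (mu_inf r m0 \<mu>). \<forall>\<epsilon>>0. \<exists>n. \<exists>f\<in>Linf_set \<mu>.
          L2_norm (mu_inf r m0 \<mu>)
            (\<lambda>\<xi>. g \<xi> - ((Uinv (mu_inf r m0 \<mu>) (U_op r m0)) ^^ n) (pi_op f phi) \<xi>) < \<epsilon>)"
proof -
  interpret solenoid_filter r \<mu> m0
    by (rule solenoid_filter.intro) (use assms in blast)+
  have "AE \<xi> in M. U phi \<xi> = pi_op m0 phi \<xi>"
    by (simp add: U_op_def pi_op_def phi_def)
  then show ?thesis
    using unitary_U representation_pi covariance orthogonality dense_U_inv_pi_phi by blast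
qed

end
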